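(* Let $\kappa$ be an infinite regular cardinal or $\infty$. Let $i<\kappa$ be a positive limit ordinal that is neither $\omega$-cofinal nor a weakly compact cardinal. Then there is a $\mathcal{P}_{<\kappa}$-ghost at $i$.
   Context: Work in ZFC. $0$ is deemed a limit ordinal. $\kappa$ is an infinite regular cardinal or the formal symbol $\infty$, which is greater than every ordinal and cardinal. $\mathcal{P}_{<\kappa}X$ is the set of subsets of $X$ of cardinality $<\kappa$, a functor on $\mathbf{Set}$ via direct image; $\mathcal{P}_{<\infty}=\mathcal{P}$ is the powerset functor. Final chain of an endofunctor $F$ on $\mathbf{Set}$: sets $\nu^{(i)}F$ for all ordinals $i$, with functorial connecting maps $\nu^{(i\geqslant j)}:\nu^{(i)}F\to\nu^{(j)}F$ for $j\leqslant i$, determined by: $\nu^{(i+1)}F=F\nu^{(i)}F$ and $\nu^{(i+1\geqslant j+1)}=F\nu^{(i\geqslant j)}$; for $i$ a limit, $\nu^{(i)}F$ is the set of families $(x_j)_{j<i}$ with $x_j\in\nu^{(j)}F$ and $\nu^{(j\geqslant k)}x_j=x_k$ for $k\leqslant j<i$, and $\nu^{(i\geqslant j)}x=x_j$ for $j<i$. So $\nu^{(0)}F=\{()\}$. Let $0_{i+1}=\emptyset$ and $0_i=(0_j)_{j<i}$ for $i$ a limit; these are elements of $\nu^{(i)}\mathcal{P}_{<\kappa}$. For a transition system (set with binary relation $\rightsquigarrow$; $y$ is a successor of $x$ if $x\rightsquigarrow y$) in which every element has $<\kappa$ successors, and an element $x$ of it, define $p_i x\in\nu^{(i)}\mathcal{P}_{<\kappa}$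 by $p_{i+1}x=\{p_i y\mid x\rightsquigarrow y\}$ and $p_i x=(p_j x)_{j<i}$ for $i$ a limit. An element of $\nu^{(i)}\mathcal{P}_{<\kappa}$ is $\mathcal{P}_{<\kappa}$-coalgebraic when it equals $p_i x$ for some such $x$. For $i$ a limit, $a\in\nu^{(i)}\mathcal{P}_{<\kappa}$ is $\mathcal{P}_{<\kappa}$-Cauchy when every component $a_j$ ($j<i$) is $\mathcal{P}_{<\kappa}$-coalgebraic. For a limit $i$ and $a,b\in\nu^{(i)}\mathcal{P}_{<\kappa}$, $b$ is a successor of $a$ when $b_j\in a_{j+1}$ for all $j<i$. A $\mathcal{P}_{<\kappa}$-ghost at a limit $i$ is a $\mathcal{P}_{<\kappa}$-Cauchy element of $\nu^{(i)}\mathcal{P}_{<\kappa}$, distinct from $0_i$, that has no successor. An ordinal is $\omega$-cofinal if it is the supremum of a strictly increasing sequence $(i_n)_{n\in\mathbb{N}}$. A tidy $\lambda$-tree is a functor $D:\lambda^{\mathrm{op}}\to\mathbf{Set}$ (levels $D_i$, connecting maps $D_i\to D_j$ for $j\leqslant i<\lambda$) such that all connecting maps are surjective, for each limit $i<\lambda$ every full branch of $(D_j)_{j<i}$ has at most one extension to a full branch of $(D_j)_{j\leqslant i}$, and $D_0$ is a singleton; a full branch is a compatible family $(x_i)_i$ with $x_i\in D_i$. A regular infinite cardinal $\lambda$ has the tree property when every tidy $\lambda$-tree with all levels of size $<\lambda$ has a full branch; it is strongly inaccessible when $|A|<\lambda$ implies $|\mathcal{P}A|<\lambda$; it is weakly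 compact when it is strongly inaccessible and has the tree property. *)

theory Defs
  imports "HOL-Library.Equipollence"
begin

text \<open>
  The final chain of the powerset functor has levels of size beyond every iterated powerset, so it
  cannot be built on an HOL type outright.  The ambient theory ZFC is therefore rendered as a type class:
  an instance is a universe of sets, with \<open>elts x\<close> the collection of members of the set \<open>x\<close>.
  Separation and replacement are second-order; choice is inherited from HOL.
  ``Set'' below means an element of the universe, an HOL set of such elements being a class in general.
\<close>

class zfc =
  fixes elts :: "'a \<Rightarrow> 'a set"
  assumes extensionality: "elts x = elts y \<Longrightarrow> x = y"
    and foundation: "wf {(x, y). x \<in> elts y}"
    and separation: "X \<subseteq> elts x \<Longrightarrow> \<exists>y. elts y = X"
    and union: "\<exists>y. elts y = (\<Union>z\<in>elts x. elts z)"
    and powerset: "\<exists>y. elts y = {z. elts z \<subseteq> elts x}"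
    and replacement: "\<exists>y. elts y = f ` elts x"
    and infinity: "\<exists>y. elts y = range (g :: nat \<Rightarrow> 'a)"

definition small :: "'a::zfc set \<Rightarrow> bool"
  where "small X \<longleftrightarrow> (\<exists>y. elts y = X)"

text \<open>Only meaningful for small \<open>X\<close>.\<close>

definition vset :: "'a::zfc set \<Rightarrow> 'a"
  where "vset X = (THE y. elts y = X)"

definition vpair :: "'a::zfc \<Rightarrow> 'a \<Rightarrow> 'a"
  where "vpair x y = vset {vset {x}, vset {x, y}}"

text \<open>\<open>family A f\<close> is the family \<open>(f x)\<^bsub>x \<in> A\<^esub>\<close>, encoded as its graph.\<close>

definition family :: "'a::zfc \<Rightarrow> ('a \<Rightarrow> 'a) \<Rightarrow> 'a"
  where "family A f = vset ((\<lambda>x. vpair x (f x)) ` elts A)"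

definition component :: "'a::zfc \<Rightarrow> 'a \<Rightarrow> 'a"
  where "component a x = (THE y. vpair x y \<in> elts a)"

subsection \<open>Ordinals and cardinals\<close>

text \<open>Von Neumann ordinals: \<open>j < i\<close> is \<open>j \<in> elts i\<close>.  Zero is a limit.\<close>

definition Ord :: "'a::zfc \<Rightarrow> bool"
  where "Ord i \<longleftrightarrow> (\<forall>j\<in>elts i. elts j \<subseteq> elts i) \<and> (\<forall>j\<in>elts i. \<forall>k\<in>elts j. elts k \<subseteq> elts j)"

definition succ :: "'a::zfc \<Rightarrow> 'a"
  where "succ i = vset (insert i (elts i))"

definition is_succ :: "'a::zfc \<Rightarrow> bool"
  where "is_succ i \<longleftrightarrow> (\<exists>j. i = succ j)"

definition pred :: "'a::zfc \<Rightarrow> 'a"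
  where "pred i = (THE j. i = succ j)"

definition limit :: "'a::zfc \<Rightarrow> bool"
  where "limit i \<longleftrightarrow> Ord i \<and> \<not> is_succ i"

definition is_sup :: "'a::zfc \<Rightarrow> 'a set \<Rightarrow> bool"
  where "is_sup i X \<longleftrightarrow> Ord i \<and> (\<forall>x\<in>X. elts x \<subseteq> elts i) \<and>
    (\<forall>j. Ord j \<and> (\<forall>x\<in>X. elts x \<subseteq> elts j) \<longrightarrow> elts i \<subseteq> elts j)"

definition omega_cofinal :: "'a::zfc \<Rightarrow> bool"
  where "omega_cofinal i \<longleftrightarrow> (\<exists>s :: nat \<Rightarrow> 'a.
    (\<forall>n. Ord (s n)) \<and> (\<forall>m n. m < n \<longrightarrow> s m \<in> elts (s n)) \<and> is_sup i (range s))"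

definition cardinal :: "'a::zfc \<Rightarrow> bool"
  where "cardinal l \<longleftrightarrow> Ord l \<and> (\<forall>j\<in>elts l. elts j \<prec> elts l)"

definition regular_cardinal :: "'a::zfc \<Rightarrow> bool"
  where "regular_cardinal l \<longleftrightarrow> cardinal l \<and> infinite (elts l) \<and>
    (\<forall>X. X \<subseteq> elts l \<and> X \<prec> elts l \<longrightarrow> (\<exists>j\<in>elts l. \<forall>x\<in>X. x \<in> elts j))"

definition strongly_inaccessible :: "'a::zfc \<Rightarrow> bool"
  where "strongly_inaccessible l \<longleftrightarrow> regular_cardinal l \<and>
    (\<forall>A :: 'a. elts A \<prec> elts l \<longrightarrow> Pow (elts A) \<prec> elts l)"

text \<open>Level \<open>i\<close> of a tree is \<open>D i\<close>; the connecting map \<open>D i \<rightarrow> D j\<close>, for \<open>j \<le> i\<close>, is \<open>d i j\<close>.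
  The values of \<open>D\<close> and \<open>d\<close> at other arguments are irrelevant.\<close>

definition inverse_system :: "'a::zfc \<Rightarrow> ('a \<Rightarrow> 'a) \<Rightarrow> ('a \<Rightarrow> 'a \<Rightarrow> 'a \<Rightarrow> 'a) \<Rightarrow> bool"
  where "inverse_system l D d \<longleftrightarrow>
    (\<forall>i\<in>elts l. \<forall>x\<in>elts (D i). d i i x = x) \<and>
    (\<forall>i\<in>elts l. \<forall>j\<in>elts (succ i). d i j ` elts (D i) \<subseteq> elts (D j)) \<and>
    (\<forall>i\<in>elts l. \<forall>j\<in>elts (succ i). \<forall>k\<in>elts (succ j). \<forall>x\<in>elts (D i).
        d j k (d i j x) = d i k x)"

text \<open>Full branches of the restriction of the tree to the levels in \<open>J\<close>; only the values of \<open>b\<close>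
  on \<open>J\<close> matter.\<close>

definition full_branch ::
    "('a::zfc \<Rightarrow> 'a) \<Rightarrow> ('a \<Rightarrow> 'a \<Rightarrow> 'a \<Rightarrow> 'a) \<Rightarrow> 'a set \<Rightarrow> ('a \<Rightarrow> 'a) \<Rightarrow> bool"
  where "full_branch D d J b \<longleftrightarrow>
    (\<forall>i\<in>J. b i \<in> elts (D i)) \<and> (\<forall>i\<in>J. \<forall>j\<in>J. j \<in> elts (succ i) \<longrightarrow> d i j (b i) = b j)"

definition tidy_tree :: "'a::zfc \<Rightarrow> ('a \<Rightarrow> 'a) \<Rightarrow> ('a \<Rightarrow> 'a \<Rightarrow> 'a \<Rightarrow> 'a) \<Rightarrow> bool"
  where "tidy_tree l D d \<longleftrightarrow> inverse_system l D d \<and>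
    (\<forall>i\<in>elts l. \<forall>j\<in>elts (succ i). d i j ` elts (D i) = elts (D j)) \<and>
    (\<forall>i\<in>elts l. limit i \<longrightarrow>
      (\<forall>b b'. full_branch D d (elts (succ i)) b \<and> full_branch D d (elts (succ i)) b' \<and>
        (\<forall>j\<in>elts i. b j = b' j) \<longrightarrow> b i = b' i)) \<and>
    (\<exists>x. elts (D (vset {})) = {x})"

definition tree_property :: "'a::zfc \<Rightarrow> bool"
  where "tree_property l \<longleftrightarrow>
    (\<forall>D d. tidy_tree l D d \<and> (\<forall>i\<in>elts l. elts (D i) \<prec> elts l) \<longrightarrow>
      (\<exists>b. full_branch D d (elts l) b))"

definition weakly_compact :: "'a::zfc \<Rightarrow> bool"
  where "weakly_compact l \<longleftrightarrow> strongly_inaccessible l \<and> tree_property l"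

subsection \<open>The bound \<open>\<kappa>\<close> and the functor\<close>

text \<open>The values of the parameter \<open>\<kappa>\<close>: a cardinal, or the formal symbol \<open>\<infinity>\<close>.\<close>

datatype 'a bound = Cardinal 'a | Infty

fun regular_bound :: "'a::zfc bound \<Rightarrow> bool"
  where "regular_bound (Cardinal l) \<longleftrightarrow> regular_cardinal l"
  | "regular_bound Infty \<longleftrightarrow> True"

fun ord_below :: "'a::zfc \<Rightarrow> 'a bound \<Rightarrow> bool"
  where "ord_below i (Cardinal l) \<longleftrightarrow> i \<in> elts l"
  | "ord_below i Infty \<longleftrightarrow> Ord i"

fun card_below :: "'a::zfc set \<Rightarrow> 'a bound \<Rightarrow> bool"
  where "card_below X (Cardinal l) \<longleftrightarrow> X \<prec> elts l"
  | "card_below X Infty \<longleftrightarrow> small X"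

definition Pow_below :: "'a::zfc bound \<Rightarrow> 'a set \<Rightarrow> 'a set"
  where "Pow_below \<kappa> X = {b. elts b \<subseteq> X \<and> card_below (elts b) \<kappa>}"

subsection \<open>Well-definedness of the encodings\<close>

lemma elts_vset [simp]: "small X \<Longrightarrow> elts (vset X) = X"
  unfolding small_def vset_def by (metis (mono_tags, lifting) extensionality the_equality)

lemma small_elts [simp]: "small (elts x)"
  by (auto simp: small_def)

lemma vset_elts [simp]: "vset (elts x) = x"
  by (rule extensionality) simp

lemma small_subset: "small X \<Longrightarrow> Y \<subseteq> X \<Longrightarrow> small Y"
  unfolding small_def using separation by blast

lemma small_image [simp]: "small X \<Longrightarrow> small ((f :: 'a::zfc \<Rightarrow> 'a) ` X)"
  unfolding small_def using replacement[of f] by auto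

lemma small_range_nat: "small (range (g :: nat \<Rightarrow> 'a::zfc))"
  unfolding small_def by (rule infinity)

lemma small_UN: "small (X :: 'a::zfc set) \<Longrightarrow> (\<And>x. x \<in> X \<Longrightarrow> small (f x :: 'a set)) \<Longrightarrow> small (\<Union>x\<in>X. f x)"
proof -
  assume X: "small X" and f: "\<And>x. x \<in> X \<Longrightarrow> small (f x)"
  have "(\<Union>x\<in>X. f x) = (\<Union>z\<in>elts (vset ((\<lambda>x. vset (f x)) ` X)). elts z)"
    using X f by simp
  then show ?thesis unfolding small_def using union by metis
qed

lemma small_pair [simp]: "small {x, y}"
proof -
  have "{x, y} = range (\<lambda>n::nat. if n = 0 then x else y)"
    by auto
  then show ?thesis by (metis small_range_nat)
qed

lemma small_singleton [simp]: "small {x}"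
  using small_pair[of x x] by simp

lemma small_empty [simp]: "small {}"
  using small_subset[OF small_singleton] by blast

lemma small_Un: "small X \<Longrightarrow> small Y \<Longrightarrow> small (X \<union> Y)"
proof -
  assume "small X" "small Y"
  then have "small (\<Union>z\<in>{vset X, vset Y}. elts z)"
    by (intro small_UN) auto
  then show ?thesis using \<open>small X\<close> \<open>small Y\<close> by simp
qed

lemma vset_inject: "small X \<Longrightarrow> small Y \<Longrightarrow> vset X = vset Y \<longleftrightarrow> X = Y"
  by (metis elts_vset)

lemma vpair_inject [simp]: "vpair x y = vpair x' y' \<longleftrightarrow> x = x' \<and> y = y'"
  unfolding vpair_def by (auto simp: vset_inject doubleton_eq_iff)

lemma component_family [simp]: "x \<in> elts A \<Longrightarrow> component (family A f) x = f x"
  unfolding component_def family_def by (rule the_equality) auto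

lemma family_cong [fundef_cong]:
  "A = B \<Longrightarrow> (\<And>x. x \<in> elts B \<Longrightarrow> f x = g x) \<Longrightarrow> family A f = family B g"
  unfolding family_def by (simp cong: image_cong)

lemma elts_succ [simp]: "elts (succ i) = insert i (elts i)"
  using small_Un[OF small_singleton[of i] small_elts[of i]] by (simp add: succ_def)

lemma mem_not_sym: "x \<in> elts y \<Longrightarrow> y \<notin> elts x"
  using wf_not_sym[OF foundation] by auto

lemma succ_inject [simp]: "succ i = succ j \<longleftrightarrow> i = j"
  by (metis elts_succ insertE insertI1 mem_not_sym)

lemma pred_succ [simp]: "pred (succ i) = i"
  by (simp add: pred_def)

lemma is_succ_succ [simp]: "is_succ (succ i)"
  by (auto simp: is_succ_def)

lemma pred_mem [simp]: "is_succ i \<Longrightarrow> pred i \<in> elts i"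
  by (auto simp: is_succ_def)

lemma Ord_mem: "Ord i \<Longrightarrow> j \<in> elts i \<Longrightarrow> Ord j"
  unfolding Ord_def by blast

lemma Ord_succ [simp]: "Ord (succ i) \<longleftrightarrow> Ord i"
proof
  assume "Ord (succ i)" then show "Ord i" by (rule Ord_mem) simp
next
  assume "Ord i" then show "Ord (succ i)" unfolding Ord_def by auto
qed

lemma limit_not_is_succ [simp]: "limit i \<Longrightarrow> \<not> is_succ i"
  by (simp add: limit_def)

subsection \<open>The final chain\<close>

text \<open>\<open>conn i j\<close> is the connecting map from level \<open>i\<close> to level \<open>j\<close>, for \<open>j \<le> i\<close>.  The third case,
  \<open>i\<close> a successor and \<open>j\<close> a limit, is forced by functoriality (see \<open>conn_conn\<close> below).  As the action
  of the functor on maps is direct image whatever \<open>\<kappa>\<close> is, \<open>conn\<close> does not depend on \<open>\<kappa>\<close>.\<close>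

function (sequential) conn :: "'a::zfc \<Rightarrow> 'a \<Rightarrow> 'a \<Rightarrow> 'a"
  where "conn i j x =
    (if i = j then x
     else if \<not> is_succ i then component x j
     else if \<not> is_succ j then family j (\<lambda>k. conn i k x)
     else vset (conn (pred i) (pred j) ` elts x))"
  by pat_completeness auto
termination
  by (relation "inv_image {(x, y). x \<in> elts y} (\<lambda>(i, j, x). j)")
    (auto intro: wf_inv_image foundation)

text \<open>\<open>level \<kappa> i\<close> is the \<open>i\<close>th set of the final chain; see \<open>small_level\<close>.\<close>

function (sequential) level :: "'a::zfc bound \<Rightarrow> 'a \<Rightarrow> 'a set"
  where "level \<kappa> i =
    (if is_succ i then Pow_below \<kappa> (level \<kappa> (pred i))
     else {a. \<exists>x. a = family i x \<and> (\<forall>j\<in>elts i. x j \<in> level \<kappa> j) \<and>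
                  (\<forall>j\<in>elts i. \<forall>k\<in>elts (succ j). conn j k (x j) = x k)})"
  by pat_completeness auto
termination
  by (relation "inv_image {(x, y). x \<in> elts y} (\<lambda>(\<kappa>, i). i)")
    (auto intro: wf_inv_image foundation)

function (sequential) zero_elt :: "'a::zfc \<Rightarrow> 'a"
  where "zero_elt i = (if is_succ i then vset {} else family i zero_elt)"
  by pat_completeness auto
termination
  by (relation "{(x, y). x \<in> elts y}") (auto intro: foundation)

subsection \<open>Transition systems and ghosts\<close>

definition transition_system :: "'a::zfc bound \<Rightarrow> 'a \<Rightarrow> ('a \<times> 'a) set \<Rightarrow> bool"
  where "transition_system \<kappa> S R \<longleftrightarrow>
    R \<subseteq> elts S \<times> elts S \<and> (\<forall>x\<in>elts S. card_below (R `` {x}) \<kappa>)"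

text \<open>\<open>projection R i x\<close> is the element \<open>p\<^sub>i x\<close>.\<close>

function (sequential) projection :: "('a \<times> 'a) set \<Rightarrow> 'a::zfc \<Rightarrow> 'a \<Rightarrow> 'a"
  where "projection R i x =
    (if is_succ i then vset (projection R (pred i) ` (R `` {x})) else family i (\<lambda>j. projection R j x))"
  by pat_completeness auto
termination
  by (relation "inv_image {(x, y). x \<in> elts y} (\<lambda>(R, i, x). i)")
    (auto intro: wf_inv_image foundation)

declare conn.simps [simp del] level.simps [simp del] zero_elt.simps [simp del] projection.simps [simp del]

definition coalgebraic :: "'a::zfc bound \<Rightarrow> 'a \<Rightarrow> 'a \<Rightarrow> bool"
  where "coalgebraic \<kappa> i a \<longleftrightarrow>
    (\<exists>S R x. transition_system \<kappa> S R \<and> x \<in> elts S \<and> a = projection R i x)"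

definition cauchy :: "'a::zfc bound \<Rightarrow> 'a \<Rightarrow> 'a \<Rightarrow> bool"
  where "cauchy \<kappa> i a \<longleftrightarrow>
    limit i \<and> a \<in> level \<kappa> i \<and> (\<forall>j\<in>elts i. coalgebraic \<kappa> j (component a j))"

definition successor :: "'a::zfc bound \<Rightarrow> 'a \<Rightarrow> 'a \<Rightarrow> 'a \<Rightarrow> bool"
  where "successor \<kappa> i a b \<longleftrightarrow>
    limit i \<and> a \<in> level \<kappa> i \<and> b \<in> level \<kappa> i \<and>
    (\<forall>j\<in>elts i. component b j \<in> elts (component a (succ j)))"

definition ghost :: "'a::zfc bound \<Rightarrow> 'a \<Rightarrow> 'a \<Rightarrow> bool"
  where "ghost \<kappa> i a \<longleftrightarrow> cauchy \<kappa> i a \<and> a \<noteq> zero_elt i \<and> (\<nexists>b. successor \<kappa> i a b)"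

subsection \<open>The final chain satisfies its defining equations\<close>

lemma conn_refl [simp]: "conn i i x = x"
  by (simp add: conn.simps)

lemma conn_succ: "conn (succ i) (succ j) x = vset (conn i j ` elts x)"
  by (subst conn.simps) auto

lemma conn_limit: "limit i \<Longrightarrow> j \<in> elts i \<Longrightarrow> conn i j x = component x j"
  using mem_not_sym by (subst conn.simps) auto

lemma conn_to_limit: "limit j \<Longrightarrow> conn (succ i) j x = family j (\<lambda>k. conn (succ i) k x)"
  by (subst conn.simps) (use limit_not_is_succ is_succ_succ in metis)

lemma level_succ: "level \<kappa> (succ i) = Pow_below \<kappa> (level \<kappa> i)"
  by (subst level.simps) simp

lemma level_limit:
  "limit i \<Longrightarrow> level \<kappa> i = {family i x |x. (\<forall>j\<in>elts i. x j \<in> level \<kappa> j) \<and>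
     (\<forall>j\<in>elts i. \<forall>k\<in>elts (succ j). conn j k (x j) = x k)}"
  by (subst level.simps) (simp add: setcompr_eq_image)

lemma zero_elt_succ: "zero_elt (succ i) = vset {}"
  by (simp add: zero_elt.simps)

lemma zero_elt_limit: "limit i \<Longrightarrow> zero_elt i = family i zero_elt"
  by (subst zero_elt.simps) simp

lemma projection_succ: "projection R (succ i) x = vset {projection R i y |y. (x, y) \<in> R}"
  by (subst projection.simps) (auto intro: arg_cong[where f = vset])

lemma projection_limit: "limit i \<Longrightarrow> projection R i x = family i (\<lambda>j. projection R j x)"
  by (subst projection.simps) simp

lemma mem_elts_trans: "Ord i \<Longrightarrow> j \<in> elts i \<Longrightarrow> k \<in> elts j \<Longrightarrow> k \<in> elts i"
  unfolding Ord_def by blast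

lemma Ord_cases:
  assumes "Ord i"
  obtains (limit) "limit i" | (succ) j where "i = succ j" "Ord j"
  using assms unfolding limit_def is_succ_def by (metis Ord_succ)

lemma succ_mem_succ: "Ord i \<Longrightarrow> succ j \<in> elts (succ i) \<Longrightarrow> j \<in> elts i"
  by (metis elts_succ insertE insertI1 mem_elts_trans succ_inject)

lemma card_below_subset: "X \<subseteq> Y \<Longrightarrow> card_below Y \<kappa> \<Longrightarrow> card_below X \<kappa>"
  by (cases \<kappa>) (auto intro: small_subset lesspoll_trans1 subset_imp_lepoll)

lemma card_below_image: "card_below X \<kappa> \<Longrightarrow> card_below (f ` X) \<kappa>"
  by (cases \<kappa>) (auto intro: lesspoll_trans1 image_lepoll)

lemma level_limitD:
  assumes "limit i" "x \<in> level \<kappa> i" "j \<in> elts i"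
  shows "component x j \<in> level \<kappa> j"
    and "k \<in> elts j \<Longrightarrow> conn j k (component x j) = component x k"
  using assms mem_elts_trans[of i j k] by (auto simp: level_limit limit_def)

lemma conn_level_conn:
  assumes "Ord j"
  shows "\<forall>i x. Ord i \<longrightarrow> j \<in> elts i \<longrightarrow> x \<in> level \<kappa> i \<longrightarrow> conn i j x \<in> level \<kappa> j \<and>
    (\<forall>k\<in>elts j. conn j k (conn i j x) = conn i k x)"
  using assms
proof (induction j rule: wf_induct_rule[OF foundation])
  case (1 j)
  show ?case
  proof (intro allI impI)
    fix i x assume i: "Ord i" "j \<in> elts i" "x \<in> level \<kappa> i"
    show "conn i j x \<in> level \<kappa> j \<and> (\<forall>k\<in>elts j. conn j k (conn i j x) = conn i k x)"
      using \<open>Ord i\<close>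
    proof (cases i rule: Ord_cases)
      case limit
      have "conn i k x = component x k" if "k \<in> elts j" for k
        using conn_limit[OF limit] mem_elts_trans[OF i(1,2) that] .
      then show ?thesis
        using level_limitD[OF limit i(3,2)] conn_limit[OF limit i(2)] by auto
    next
      case (succ i')
      show ?thesis using \<open>Ord j\<close>
      proof (cases j rule: Ord_cases)
        case limit
        have IH: "conn i k x \<in> level \<kappa> k"
            "\<And>m. m \<in> elts k \<Longrightarrow> conn k m (conn i k x) = conn i m x"
          if "k \<in> elts j" for k
          using "1.IH"[of k] that i mem_elts_trans[OF i(1,2) that] Ord_mem[OF \<open>Ord j\<close> that] by auto
        have eq: "conn i j x = family j (\<lambda>k. conn i k x)"
          using conn_to_limit[OF limit] succ by simp
        have "conn i j x \<in> level \<kappa> j"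
          unfolding eq level_limit[OF limit] using IH by auto
        moreover have "conn j k (conn i j x) = conn i k x" if "k \<in> elts j" for k
          using that eq conn_limit[OF limit that] by simp
        ultimately show ?thesis by blast
      next
        case j: (succ j')
        have j'i': "j' \<in> elts i'"
          using succ_mem_succ i succ j by simp
        have x: "elts x \<subseteq> level \<kappa> i'" "card_below (elts x) \<kappa>"
          using i(3) succ by (auto simp: level_succ Pow_below_def)
        have IH: "conn i' j' y \<in> level \<kappa> j'"
            "\<And>m. m \<in> elts j' \<Longrightarrow> conn j' m (conn i' j' y) = conn i' m y"
          if "y \<in> elts x" for y
          using "1.IH"[of j'] that j j'i' succ x by auto
        have eq: "elts (conn i j x) = conn i' j' ` elts x"
          by (simp add: succ j conn_succ)
        have lev: "conn i j x \<in> level \<kappa> j"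
          using IH x eq by (auto simp: j level_succ Pow_below_def intro: card_below_image)
        have "k \<in> elts j \<Longrightarrow> conn j k (conn i j x) = conn i k x" for k
        proof (induction k rule: wf_induct_rule[OF foundation])
          case (1 k)
          note kj = \<open>k \<in> elts j\<close>
          have "Ord k" using Ord_mem[OF \<open>Ord j\<close> kj] .
          then show ?case
          proof (cases k rule: Ord_cases)
            case limit
            have "conn j m (conn i j x) = conn i m x" if "m \<in> elts k" for m
              using "1.IH"[of m] that mem_elts_trans[OF \<open>Ord j\<close> kj that] by simp
            then show ?thesis
              using conn_to_limit[OF limit] succ j by (auto intro: family_cong)
          next
            case k: (succ k')
            have "k' \<in> elts j'"
              using succ_mem_succ kj k j by simp
            then have "conn j' k' ` conn i' j' ` elts x = conn i' k' ` elts x"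
              using IH(2) by (auto simp: image_image)
            then show ?thesis
              using eq by (simp add: succ j k conn_succ)
          qed
        qed
        with lev show ?thesis by blast
      qed
    qed
  qed
qed

lemma conn_level:
  "Ord i \<Longrightarrow> j \<in> elts (succ i) \<Longrightarrow> x \<in> level \<kappa> i \<Longrightarrow> conn i j x \<in> level \<kappa> j"
  using conn_level_conn[of j] Ord_mem by auto

lemma conn_conn:
  "Ord i \<Longrightarrow> j \<in> elts (succ i) \<Longrightarrow> k \<in> elts (succ j) \<Longrightarrow> x \<in> level \<kappa> i \<Longrightarrow>
    conn j k (conn i j x) = conn i k x"
  using conn_level_conn[of j] Ord_mem by auto

lemma small_families:
  assumes "\<And>j. j \<in> elts i \<Longrightarrow> small (X j)"
  shows "small {family i x |x. \<forall>j\<in>elts i. x j \<in> X j}"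
proof -
  have small_Pow: "small {b. elts b \<subseteq> Y}" if "small Y" for Y :: "'a set"
    using that powerset unfolding small_def by metis
  define P where "P = (\<Union>j\<in>elts i. vpair j ` X j)"
  have "small P"
    unfolding P_def using assms by (intro small_UN) auto
  then have "small {b. elts b \<subseteq> P}"
    by (rule small_Pow)
  moreover have "elts (family i x) \<subseteq> P" if "\<forall>j\<in>elts i. x j \<in> X j" for x
    using that unfolding family_def P_def by (subst elts_vset) auto
  ultimately show ?thesis
    by (elim small_subset) blast
qed

lemma small_level: "Ord i \<Longrightarrow> small (level \<kappa> i)"
proof (induction i rule: wf_induct_rule[OF foundation])
  case (1 i)
  then have IH: "small (level \<kappa> j)" if "j \<in> elts i" for j
    using that Ord_mem by auto
  show ?case using \<open>Ord i\<close>
  proof (cases i rule: Ord_cases)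
    case limit
    show ?thesis
      by (rule small_subset[OF small_families[of i "level \<kappa>"]])
        (use IH in \<open>auto simp: level_limit[OF limit]\<close>)
  next
    case (succ j)
    have "small {b. elts b \<subseteq> level \<kappa> j}"
      using IH[of j] succ powerset unfolding small_def by (metis elts_succ insertI1)
    then show ?thesis
      by (rule small_subset) (auto simp: succ level_succ Pow_below_def)
  qed
qed

lemma conn_projection:
  assumes "Ord j" "transition_system \<kappa> S R"
  shows "\<forall>i x. Ord i \<longrightarrow> j \<in> elts i \<longrightarrow> conn i j (projection R i x) = projection R j x"
  using assms(1)
proof (induction j rule: wf_induct_rule[OF foundation])
  case (1 j)
  have succs: "small {y. (x, y) \<in> R}" for x
    by (rule small_subset[OF small_elts[of S]])
      (use assms(2) in \<open>auto simp: transition_system_def\<close>)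
  have proj: "elts (projection R (succ m) x) = projection R m ` {y. (x, y) \<in> R}" for m x
    using succs by (simp add: projection_succ setcompr_eq_image)
  show ?case
  proof (intro allI impI)
    fix i x assume i: "Ord i" "j \<in> elts i"
    show "conn i j (projection R i x) = projection R j x"
      using \<open>Ord i\<close>
    proof (cases i rule: Ord_cases)
      case limit
      then show ?thesis using i by (simp add: conn_limit projection_limit)
    next
      case (succ i')
      show ?thesis using \<open>Ord j\<close>
      proof (cases j rule: Ord_cases)
        case limit
        have "conn i k (projection R i x) = projection R k x" if "k \<in> elts j" for k
          using "1.IH"[of k] that i mem_elts_trans[OF i that] Ord_mem[OF \<open>Ord j\<close> that] by auto
        then show ?thesis
          using conn_to_limit[OF limit] succ
          by (auto simp: projection_limit[OF limit] intro: family_cong)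
      next
        case j: (succ j')
        have "j' \<in> elts i'" using succ_mem_succ i succ j by simp
        then have "conn i' j' (projection R i' y) = projection R j' y" for y
          using "1.IH"[of j'] j succ by auto
        then show ?thesis
          by (simp add: succ j conn_succ proj image_image)
            (simp add: projection_succ setcompr_eq_image)
      qed
    qed
  qed
qed

lemma projection_level:
  assumes "transition_system \<kappa> S R" "Ord i" "x \<in> elts S"
  shows "projection R i x \<in> level \<kappa> i"
  using assms(2,3)
proof (induction i arbitrary: x rule: wf_induct_rule[OF foundation])
  case (1 i)
  then have IH: "projection R j y \<in> level \<kappa> j" if "j \<in> elts i" "y \<in> elts S" for j y
    using that Ord_mem by auto
  show ?case using \<open>Ord i\<close>
  proof (cases i rule: Ord_cases)
    case limit
    have "conn j k (projection R j x) = projection R k x"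
      if "j \<in> elts i" "k \<in> elts (succ j)" for j k
      using that conn_projection[OF _ assms(1), of k] Ord_mem[OF \<open>Ord i\<close>] Ord_mem[of j k] by auto
    then show ?thesis
      using IH \<open>x \<in> elts S\<close> by (auto simp: level_limit[OF limit] projection_limit[OF limit])
  next
    case (succ j)
    have R: "R `` {x} \<subseteq> elts S" "card_below (R `` {x}) \<kappa>"
      using assms(1) \<open>x \<in> elts S\<close> by (auto simp: transition_system_def)
    have "elts (projection R i x) = projection R j ` (R `` {x})"
      using small_subset[OF small_elts R(1)]
      by (simp add: succ projection_succ setcompr_eq_image Image_singleton)
    then show ?thesis
      using R IH succ by (auto simp: level_succ Pow_below_def intro: card_below_image)
  qed
qed

lemma zero_elt_eq_projection: "Ord i \<Longrightarrow> zero_elt i = projection {} i x"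
proof (induction i rule: wf_induct_rule[OF foundation])
  case (1 i)
  then have IH: "zero_elt j = projection {} j x" if "j \<in> elts i" for j
    using that Ord_mem by auto
  show ?case using \<open>Ord i\<close>
    by (cases i rule: Ord_cases)
      (use IH in \<open>auto simp: zero_elt_limit projection_limit zero_elt_succ projection_succ intro: family_cong\<close>)
qed

lemma zero_elt_level:
  assumes "regular_bound \<kappa>" "Ord i"
  shows "zero_elt i \<in> level \<kappa> i"
proof -
  have "card_below {} \<kappa>"
  proof (cases \<kappa>)
    case (Cardinal l)
    then have "elts l \<noteq> {}"
      using assms(1) by (auto simp: regular_cardinal_def)
    then show ?thesis
      using Cardinal by (auto simp: lesspoll_def eqpoll_def bij_betw_def)
  qed simp
  then have "transition_system \<kappa> (vset {undefined}) {}"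
    by (simp add: transition_system_def)
  then show ?thesis
    using projection_level[of \<kappa> "vset {undefined}" "{}" i undefined]
      zero_elt_eq_projection[OF assms(2), of undefined] assms(2) by simp
qed

end

theory Submission
  imports Defs
begin

text \<open>
  Sets under membership form a transition system, in which \<open>x\<close> and \<open>y\<close> have the same projection at
  level \<open>j\<close> iff they are bisimilar up to depth \<open>j\<close>.  Let \<open>X j\<close>, for \<open>j < i\<close>, be
  nonempty sets of states such that \<open>X j\<close> and \<open>X k\<close> agree up to bisimilarity of depth \<open>k\<close> when \<open>k \<le> j\<close>.
  The \<open>X j\<close>, as states, give a Cauchy element of level \<open>i\<close>.  A successor of it is a choice of \<open>f j \<in> X j\<close>
  with \<open>f j\<close> and \<open>f k\<close> bisimilar up to depth \<open>k\<close>, and so it suffices to exclude such full branches.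

  A state is made from a set \<open>W\<close> of pairs \<open>(k, q)\<close> with \<open>k < i\<close>, in such a way that depth \<open>j\<close> sees only the
  pairs with \<open>k < j\<close>, while every pair is seen at some depth below \<open>i\<close>.  If \<open>i\<close> does not have the tree
  property, then \<open>W\<close> encodes the path to a node of a tree that has no full branch.  If \<open>i\<close> is not
  strongly inaccessible, then some \<open>L\<close> unbounded in \<open>i\<close> injects into the powerset of some \<open>t < i\<close>.  In this
  case \<open>W\<close> encodes, following Higman and Stone, a finite sequence \<open>0 = x\<^sub>0 < x\<^sub>1 < \<dots> < x\<^sub>n\<close> from \<open>L\<close> by the
  pairs \<open>(x\<^sub>k, q)\<close>, with \<open>q \<subseteq> t\<close> the code of \<open>x\<^bsub>k+1\<^esub>\<close>, and the states at level \<open>j\<close> are those with \<open>x\<^sub>n \<ge> j\<close>.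
  A full branch would be an infinite such sequence; this is bounded below \<open>i\<close>, as \<open>i\<close> is not
  \<open>\<omega>\<close>-cofinal, and then a single \<open>W\<close> would contain infinitely many pairs.
\<close>

section \<open>Closure properties of the sets that inject into a fixed infinite set\<close>

section \<open>Cardinality\<close>

lemma lepoll_linear:
  fixes A :: "'a set" and B :: "'b set"
  shows "A \<lesssim> B \<or> B \<lesssim> A"
  using ordLeq_total[OF card_of_Well_order card_of_Well_order, of A B]
  by (simp add: lepoll_def card_of_ordLeq)

lemma Times_lepoll_self:
  assumes "infinite A"
  shows "A \<times> A \<lesssim> A"
  using card_of_Times_same_infinite[OF assms] eqpoll_imp_lepoll
  by (auto simp: eqpoll_iff_card_of_ordIso)

lemma Sigma_lepoll:
  assumes "infinite A" "I \<lesssim> A" "\<And>x. x \<in> I \<Longrightarrow> B x \<lesssim> A"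
  shows "Sigma I B \<lesssim> A"
proof -
  from \<open>I \<lesssim> A\<close> obtain h where "inj_on h I" "h ` I \<subseteq> A"
    by (auto simp: lepoll_def)
  then have "Sigma I B \<lesssim> A \<times> A"
    by (rule Sigma_inj_lepoll_mono) (use assms in auto)
  then show ?thesis
    using Times_lepoll_self[OF \<open>infinite A\<close>] lepoll_trans by blast
qed

lemma UN_lepoll:
  assumes "infinite A" "I \<lesssim> A" "\<And>x. x \<in> I \<Longrightarrow> B x \<lesssim> A"
  shows "(\<Union>x\<in>I. B x) \<lesssim> A"
proof -
  have "(\<Union>x\<in>I. B x) = snd ` Sigma I B"
    by force
  then show ?thesis
    by (simp add: lepoll_trans[OF image_lepoll Sigma_lepoll[OF assms]])
qed

lemma Un_lepoll:
  assumes "infinite A" "B \<lesssim> A" "C \<lesssim> A"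
  shows "B \<union> C \<lesssim> A"
proof -
  have "(\<Union>b\<in>UNIV. if b then B else C) \<lesssim> A"
    by (rule UN_lepoll[OF assms(1)]) (use assms in \<open>auto intro: finite_lepoll_infinite\<close>)
  then show ?thesis
    by (simp add: UNIV_bool Un_commute)
qed

text \<open>Every finite subset of \<open>B\<close> arises from the empty set by finitely many
  insertions, so \<open>Fpow B\<close> is covered by countably many sets \<open>F n\<close>, each no
  larger than \<open>A\<close>.\<close>

lemma Fpow_lepoll:
  assumes "infinite A" "B \<lesssim> A"
  shows "Fpow B \<lesssim> A"
proof -
  define F where "F n = ((\<lambda>X. (\<lambda>(b, Y). insert b Y) ` (B \<times> X)) ^^ n) {{}}" for n
  have F_Suc: "F (Suc n) = (\<lambda>(b, Y). insert b Y) ` (B \<times> F n)" for n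
    by (simp add: F_def)
  have F: "F n \<lesssim> A" for n
  proof (induction n)
    case 0
    then show ?case using assms by (simp add: F_def finite_lepoll_infinite)
  next
    case (Suc n)
    then have "B \<times> F n \<lesssim> A"
      using assms by (intro Sigma_lepoll) auto
    then show ?case
      unfolding F_Suc by (rule lepoll_trans[OF image_lepoll])
  qed
  have "X \<in> (\<Union>n. F n)" if "finite X" "X \<subseteq> B" for X
    using that
  proof (induction X rule: finite_induct)
    case empty
    have "{} \<in> F 0" by (simp add: F_def)
    then show ?case by blast
  next
    case (insert x X)
    then obtain n where "X \<in> F n" by auto
    then have "insert x X \<in> F (Suc n)"
      using insert.prems by (auto simp: F_Suc)
    then show ?case by blast
  qed
  then have "Fpow B \<subseteq> (\<Union>n. F n)"
    by (auto simp: Fpow_def)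
  moreover have "(\<Union>n. F n) \<lesssim> A"
    using F assms by (intro UN_lepoll) (auto simp: infinite_le_lepoll)
  ultimately show ?thesis
    using subset_imp_lepoll lepoll_trans by blast
qed

lemma Pow_lepoll_mono: "A \<lesssim> B \<Longrightarrow> Pow A \<lesssim> Pow B"
  unfolding lepoll_def by (metis image_Pow_surj inj_on_image_Pow image_Pow_mono)

text \<open>Replacement and separation turn a cardinality bound into sethood, so that
  \<open>vset\<close> may be applied.\<close>

lemma small_lepoll:
  fixes X :: "'a::zfc set"
  assumes "X \<lesssim> Y" "small (Y :: 'a set)"
  shows "small X"
proof -
  from assms obtain f where "X \<subseteq> f ` Y"
    by (auto simp: lepoll_iff)
  then show ?thesis
    using assms small_image small_subset by blast
qed

section \<open>Von Neumann ordinals, limits and bounded sequences\<close>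

section \<open>Ordinals\<close>

lemma mem_irrefl [simp]: "x \<notin> elts x"
  using mem_not_sym by blast

lemma Ord_linear:
  assumes "Ord i" "Ord j"
  shows "i \<in> elts j \<or> i = j \<or> j \<in> elts i"
  using assms
proof (induction i arbitrary: j rule: wf_induct_rule[OF foundation])
  case (1 i)
  note outer = this
  from \<open>Ord j\<close> show ?case
  proof (induction j rule: wf_induct_rule[OF foundation])
    case (1 j)
    show ?case
    proof (rule ccontr)
      assume neg: "\<not> (i \<in> elts j \<or> i = j \<or> j \<in> elts i)"
      have "u \<in> elts j" if "u \<in> elts i" for u
        using outer(1)[of u j] that neg Ord_mem[OF outer(2) that] \<open>Ord j\<close>
          mem_elts_trans[OF outer(2) that] by auto
      moreover have "v \<in> elts i" if "v \<in> elts j" for v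
        using 1(1)[of v] that neg Ord_mem[OF \<open>Ord j\<close> that] mem_elts_trans[OF \<open>Ord j\<close> that] by auto
      ultimately show False
        using neg extensionality[of i j] by auto
    qed
  qed
qed

lemma Ord_mem_subset: "Ord j \<Longrightarrow> i \<in> elts j \<Longrightarrow> elts i \<subseteq> elts j"
  using mem_elts_trans by blast

lemma Ord_subset_iff:
  assumes "Ord i" "Ord j"
  shows "elts i \<subseteq> elts j \<longleftrightarrow> i \<in> elts (succ j)"
  using Ord_linear[OF assms] Ord_mem_subset[of j i] assms mem_irrefl by auto

lemma Ord_subset_linear:
  assumes "Ord i" "Ord j"
  shows "elts i \<subseteq> elts j \<or> elts j \<subseteq> elts i"
  using Ord_linear[OF assms] Ord_mem_subset assms by blast

lemma Ord_not_mem_iff: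
  assumes "Ord i" "Ord j"
  shows "i \<notin> elts j \<longleftrightarrow> elts j \<subseteq> elts i"
  using Ord_linear[OF assms] Ord_mem_subset assms by auto

lemma Ord_zero [simp]: "Ord (vset {})"
  by (simp add: Ord_def)

lemma limit_Ord: "limit i \<Longrightarrow> Ord i"
  by (simp add: limit_def)

lemma limit_succ_mem:
  assumes "limit i" "j \<in> elts i"
  shows "succ j \<in> elts i"
proof -
  have "Ord j" "Ord i"
    using assms Ord_mem limit_Ord by auto
  moreover have "i \<noteq> succ j"
    using assms limit_not_is_succ is_succ_succ by metis
  ultimately show ?thesis
    using Ord_linear[of "succ j" i] assms mem_not_sym by auto
qed

lemma limit_zero_mem:
  assumes "limit i" "i \<noteq> vset {}"
  shows "vset {} \<in> elts i"
  using Ord_linear[OF Ord_zero limit_Ord[OF assms(1)]] assms(2) by auto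

lemma limit_max_mem:
  assumes "limit i" "j \<in> elts i" "k \<in> elts i"
  obtains m where "m \<in> elts i" "elts j \<subseteq> elts m" "elts k \<subseteq> elts m"
  using Ord_subset_linear[of j k] assms limit_Ord Ord_mem by blast

lemma infinite_limit:
  fixes i :: "'a::zfc"
  assumes "limit i" "i \<noteq> vset {}"
  shows "infinite (elts i)"
proof -
  define s where "s n = (succ ^^ n) (vset {} :: 'a)" for n
  have s: "s n \<in> elts i" for n
    by (induction n) (use assms in \<open>auto simp: s_def limit_zero_mem limit_succ_mem\<close>)
  have "s m \<in> elts (s n)" if "m < n" for m n
    using that by (induction n) (auto simp: s_def less_Suc_eq)
  then have "inj s"
    by (intro linorder_injI) (metis mem_irrefl)
  then show ?thesis
    using s by (meson finite_subset image_subsetI range_inj_infinite)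
qed

text \<open>Without an upper bound below \<open>i\<close>, the strictly increasing sequence would
  have \<open>i\<close> as its supremum.\<close>

lemma not_omega_cofinal_bounded:
  assumes "Ord i" "\<not> omega_cofinal i" "\<And>n. s n \<in> elts i" "\<And>n. s n \<in> elts (s (Suc n))"
  obtains m where "m \<in> elts i" "\<And>n :: nat. elts (s n) \<subseteq> elts m"
proof -
  have Ord: "Ord (s n)" for n
    using assms Ord_mem by blast
  have "s m \<in> elts (s n)" if "m < n" for m n
    using that
  proof (induction n)
    case (Suc n)
    then show ?case
      using assms(4)[of n] mem_elts_trans[OF Ord[of "Suc n"]] by (auto simp: less_Suc_eq)
  qed simp
  then have "\<not> is_sup i (range s)"
    using assms(2) Ord unfolding omega_cofinal_def by blast
  then obtain j where "Ord j" "\<And>n. elts (s n) \<subseteq> elts j" "\<not> elts i \<subseteq> elts j"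
    using assms(1,3) Ord_mem_subset unfolding is_sup_def by blast
  then show thesis
    using that Ord_not_mem_iff[of j i] assms(1) by blast
qed

text \<open>The ordinal is the order type of \<open>X\<close>, obtained as its Mostowski collapse.\<close>

lemma lesspoll_Ord:
  fixes i :: "'a::zfc"
  assumes "Ord i" "Y \<prec> elts i"
  obtains t where "t \<in> elts i" "Y \<lesssim> elts t"
proof -
  obtain X where X: "X \<subseteq> elts i" "Y \<approx> X"
    using assms(2) unfolding lesspoll_def lepoll_def
    by (metis eqpoll_sym inj_on_image_eqpoll_self)
  define c :: "'a \<Rightarrow> 'a"
    where "c = wfrec {(x, y). x \<in> elts y} (\<lambda>c x. vset (c ` (X \<inter> elts x)))"
  have c: "c x = vset (c ` (X \<inter> elts x))" for x
  proof -
    have "c x = vset (cut c {(x, y). x \<in> elts y} x ` (X \<inter> elts x))"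
      unfolding c_def by (subst wfrec[OF foundation]) simp
    also have "cut c {(x, y). x \<in> elts y} x ` (X \<inter> elts x) = c ` (X \<inter> elts x)"
      by (intro image_cong) (auto simp: cut_def)
    finally show ?thesis .
  qed
  have elts_c: "elts (c x) = c ` (X \<inter> elts x)" for x
    by (subst c) (simp add: small_subset[OF small_elts[of x] Int_lower2])
  have Ord_X: "Ord x" if "x \<in> X" for x
    using that X assms Ord_mem by blast
  have mono: "c x \<in> elts (c y)" if "x \<in> elts y" "x \<in> X" for x y
    using that by (auto simp: elts_c)
  have inj: "inj_on c X"
    by (rule inj_onI) (metis Ord_X Ord_linear mem_irrefl mono)
  have Ord_c: "Ord (c x)" if "x \<in> X" for x
  proof -
    have trans: "elts v \<subseteq> elts (c x)" if "v \<in> elts (c x)" "Ord x" for v x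
      using that mem_elts_trans[of x] by (auto simp: elts_c)
    have "\<exists>y\<in>X. v = c y" if "v \<in> elts (c x)" for v
      using that by (auto simp: elts_c)
    then show ?thesis
      unfolding Ord_def using trans Ord_X[OF \<open>x \<in> X\<close>] Ord_X by metis
  qed
  \<comment> \<open>The collapse never moves an ordinal up, so its range stays below
    \<open>i\<close>.\<close>
  have le: "elts (c x) \<subseteq> elts x" if "x \<in> X" for x
    using that
  proof (induction x rule: wf_induct_rule[OF foundation])
    case (1 x)
    show ?case
    proof
      fix v assume "v \<in> elts (c x)"
      then obtain y where y: "y \<in> X" "y \<in> elts x" "v = c y"
        by (auto simp: elts_c)
      then have "c y \<in> elts (succ y)"
        using 1 Ord_subset_iff[of "c y" y] Ord_c Ord_X by auto
      then show "v \<in> elts x"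
        using y mem_elts_trans[OF Ord_X[OF \<open>x \<in> X\<close>]] by auto
    qed
  qed
  define t where "t = vset (c ` X)"
  have t: "elts t = c ` X"
    using X by (simp add: t_def small_subset[OF small_elts[of i]])
  have "Ord t"
    unfolding Ord_def t using Ord_c by (force simp: elts_c Ord_def)
  have "c x \<in> elts i" if "x \<in> X" for x
    using Ord_subset_iff[OF Ord_c Ord_X, of x x] le that X mem_elts_trans[OF assms(1), of x "c x"] by auto
  then have "elts t \<subseteq> elts i"
    using t by auto
  have "X \<approx> elts t"
    unfolding t using inj inj_on_image_eqpoll_self eqpoll_sym by blast
  then have "Y \<approx> elts t"
    using X eqpoll_trans by blast
  \<comment> \<open>The strictness of \<open>Y \<prec> elts i\<close> makes the inclusion of
    \<open>t\<close> in \<open>i\<close> proper.\<close>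
  then have "t \<noteq> i"
    using assms(2) by (auto simp: lesspoll_def)
  then have "t \<in> elts i"
    using \<open>elts t \<subseteq> elts i\<close> Ord_subset_iff[OF \<open>Ord t\<close> assms(1)] by auto
  then show thesis
    using that \<open>Y \<approx> elts t\<close> eqpoll_imp_lepoll by blast
qed

section \<open>Bisimilarity up to an ordinal depth between sets under membership\<close>

section \<open>The universe as a transition system\<close>

text \<open>Membership makes the universe a (class-sized) transition system, in which every set, as a state,
  has its elements as successors.\<close>

definition memproj :: "'a::zfc \<Rightarrow> 'a \<Rightarrow> 'a"
  where "memproj j x = projection {(u, v). v \<in> elts u} j x"

definition tclosure :: "'a::zfc \<Rightarrow> 'a set"
  where "tclosure x = {y. (y, x) \<in> {(u, v). u \<in> elts v}\<^sup>*}"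

lemma tclosure_refl [simp]: "x \<in> tclosure x"
  by (simp add: tclosure_def)

lemma tclosure_closed: "v \<in> elts u \<Longrightarrow> u \<in> tclosure x \<Longrightarrow> v \<in> tclosure x"
  unfolding tclosure_def by (auto intro: converse_rtrancl_into_rtrancl)

text \<open>Union and replacement suffice, by membership induction. This cuts the class-sized system
  down to the set-sized ones that \<open>coalgebraic\<close> requires.\<close>

lemma small_tclosure: "small (tclosure x)"
proof (induction x rule: wf_induct_rule[OF foundation])
  case (1 x)
  have "tclosure x \<subseteq> {x} \<union> (\<Union>u\<in>elts x. tclosure u)"
    by (auto simp: tclosure_def elim: rtranclE)
  moreover have "small ({x} \<union> (\<Union>u\<in>elts x. tclosure u))"
    using 1 by (intro small_Un small_UN) auto
  ultimately show ?case
    using small_subset by blast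
qed

lemma elts_memproj_succ: "elts (memproj (succ j) x) = memproj j ` elts x"
  unfolding memproj_def by (simp add: projection_succ setcompr_eq_image)

lemma memproj_limit: "limit i \<Longrightarrow> memproj i x = family i (\<lambda>j. memproj j x)"
  unfolding memproj_def by (simp add: projection_limit)

text \<open>The recursion at \<open>x\<close> consults only states reachable from \<open>x\<close>,
  and these stay in the closed \<open>S\<close>.\<close>

lemma projection_restrict:
  assumes "\<And>u v. u \<in> S \<Longrightarrow> v \<in> elts u \<Longrightarrow> v \<in> S" "x \<in> S"
  shows "projection {(u, v). u \<in> S \<and> v \<in> elts u} j x = memproj j x"
  using assms(2)
proof (induction j arbitrary: x rule: wf_induct_rule[OF foundation])
  case (1 j)
  let ?R = "{(u, v). u \<in> S \<and> v \<in> elts u}"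
  have im: "?R `` {x} = elts x" "{(u, v). v \<in> elts u} `` {x} = elts x"
    using \<open>x \<in> S\<close> by auto
  show ?case
  proof (cases "is_succ j")
    case True
    then have "projection ?R (pred j) ` elts x = memproj (pred j) ` elts x"
      using 1 assms(1) by (intro image_cong) auto
    then show ?thesis
      using True im by (simp add: projection.simps[of _ j] memproj_def)
  next
    case False
    then have "family j (\<lambda>k. projection ?R k x) = family j (\<lambda>k. memproj k x)"
      using 1 by (intro family_cong) auto
    then show ?thesis
      using False by (simp add: projection.simps[of _ j] memproj_def)
  qed
qed

lemma memproj_transition_system:
  assumes "\<And>y. y \<in> tclosure x \<Longrightarrow> card_below (elts y) \<kappa>"
  obtains S R where "transition_system \<kappa> S R" "x \<in> elts S" "\<And>j. memproj j x = projection R j x"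
proof
  let ?R = "{(u, v). u \<in> tclosure x \<and> v \<in> elts u}"
  have R: "?R `` {u} = elts u" if "u \<in> tclosure x" for u
    using that by auto
  have "?R \<subseteq> tclosure x \<times> tclosure x"
    using tclosure_closed by auto
  then show "transition_system \<kappa> (vset (tclosure x)) ?R"
    unfolding transition_system_def elts_vset[OF small_tclosure] using assms R by simp
  show "x \<in> elts (vset (tclosure x))"
    by (simp add: small_tclosure)
  show "memproj j x = projection ?R j x" for j
    by (rule projection_restrict[symmetric]) (auto intro: tclosure_closed)
qed

lemma conn_memproj:
  assumes "Ord j" "k \<in> elts (succ j)"
  shows "conn j k (memproj j x) = memproj k x"
proof -
  \<comment> \<open>\<open>Infty\<close> asks only that the successors of a state form a set, so
    every \<open>x\<close> qualifies; \<open>conn\<close> does not depend on the bound.\<close>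
  obtain S R where "transition_system Infty S R" "\<And>j. memproj j x = projection R j x"
    by (rule memproj_transition_system[of x Infty]) auto
  then show ?thesis
    using conn_projection[of k Infty S R] assms Ord_mem by auto
qed

lemma memproj_mono:
  assumes "Ord j" "Ord k" "elts k \<subseteq> elts j" "memproj j x = memproj j y"
  shows "memproj k x = memproj k y"
  using assms Ord_subset_iff conn_memproj by metis

lemma memproj_image_mono:
  assumes "Ord j" "Ord k" "elts k \<subseteq> elts j" "memproj j ` X = memproj j ` Y"
  shows "memproj k ` X = memproj k ` Y"
proof -
  have "memproj k ` Z = conn j k ` memproj j ` Z" for Z
    using assms Ord_subset_iff[of k j] by (simp add: image_image conn_memproj)
  then show ?thesis
    using assms(4) by simp
qed

text \<open>Level \<open>succ k\<close> records the elements at depth \<open>k\<close>, and a limit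
  level is determined by those below it. The criterion treats both kinds of depth alike.\<close>

lemma memproj_eq_iff:
  assumes "Ord j"
  shows "memproj j x = memproj j y \<longleftrightarrow> (\<forall>k\<in>elts j. memproj k ` elts x = memproj k ` elts y)"
proof
  assume eq: "memproj j x = memproj j y"
  show "\<forall>k\<in>elts j. memproj k ` elts x = memproj k ` elts y"
  proof
    fix k assume k: "k \<in> elts j"
    have "Ord (succ k)" "elts (succ k) \<subseteq> elts j"
      using k Ord_mem[OF assms k] Ord_mem_subset[OF assms k] by auto
    then have "memproj (succ k) x = memproj (succ k) y"
      using memproj_mono assms eq by blast
    then show "memproj k ` elts x = memproj k ` elts y"
      using elts_memproj_succ by metis
  qed
next
  assume "\<forall>k\<in>elts j. memproj k ` elts x = memproj k ` elts y"
  then show "memproj j x = memproj j y"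
    using assms
  proof (induction j rule: wf_induct_rule[OF foundation])
    case (1 j)
    show ?case using \<open>Ord j\<close>
    proof (cases j rule: Ord_cases)
      case limit
      have "memproj k x = memproj k y" if "k \<in> elts j" for k
        using 1 that mem_elts_trans[OF \<open>Ord j\<close> that] Ord_mem[OF \<open>Ord j\<close> that] by blast
      then show ?thesis
        using limit by (auto simp: memproj_limit intro: family_cong)
    next
      case (succ k)
      then show ?thesis
        using 1 by (intro extensionality) (simp add: elts_memproj_succ)
    qed
  qed
qed

text \<open>Agreement of the elements at depth \<open>j\<close> passes to all smaller depths, as
  \<open>memproj_eq_iff\<close> demands. Having the same \<open>j\<close> on both sides lets the
  rule be iterated through nested sets.\<close>

lemma memproj_cong:
  assumes "Ord j" "memproj j ` elts x = memproj j ` elts y"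
  shows "memproj j x = memproj j y"
  unfolding memproj_eq_iff[OF assms(1)]
  using memproj_image_mono[OF assms(1) _ _ assms(2)] Ord_mem Ord_mem_subset assms(1) by blast

subsection \<open>Sets of hereditarily bounded cardinality\<close>

text \<open>The bound is the size of \<open>i\<close> and not \<kappa>, so the same sets serve for
  every \<kappa> above \<open>i\<close>, including \<open>Infty\<close>.\<close>

inductive hered :: "'a::zfc \<Rightarrow> 'a \<Rightarrow> bool" for i
  where "elts x \<lesssim> elts i \<Longrightarrow> (\<And>u. u \<in> elts x \<Longrightarrow> hered i u) \<Longrightarrow> hered i x"

lemma hered_lepoll: "hered i x \<Longrightarrow> elts x \<lesssim> elts i"
  by (erule hered.cases) simp

lemma hered_mem: "hered i x \<Longrightarrow> u \<in> elts x \<Longrightarrow> hered i u"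
  by (erule hered.cases) simp

lemma hered_tclosure: "y \<in> tclosure x \<Longrightarrow> hered i x \<Longrightarrow> elts y \<lesssim> elts i"
proof -
  assume "hered i x" "y \<in> tclosure x"
  from this(2) have "(y, x) \<in> {(u, v). u \<in> elts v}\<^sup>*"
    by (simp add: tclosure_def)
  then have "hered i y"
  proof (induction rule: converse_rtrancl_induct)
    case (step y z)
    then show ?case using hered_mem[of i z y] by simp
  qed fact
  then show ?thesis
    by (rule hered_lepoll)
qed

lemma hered_finite:
  assumes "infinite (elts i)" "finite X" "\<And>x. x \<in> X \<Longrightarrow> hered i x" "small X"
  shows "hered i (vset X)"
  by (rule hered.intros) (use assms in \<open>auto intro: finite_lepoll_infinite\<close>)

lemma hered_vpair:
  assumes "infinite (elts i)" "hered i x" "hered i y"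
  shows "hered i (vpair x y)"
  unfolding vpair_def
  by (rule hered_finite) (use assms in \<open>auto intro!: hered_finite\<close>)

lemma hered_subset_Ord:
  assumes "Ord i"
  shows "elts x \<subseteq> elts i \<Longrightarrow> hered i x"
proof (induction x rule: wf_induct_rule[OF foundation])
  case (1 x)
  have "hered i u" if "u \<in> elts x" for u
    using 1 that Ord_mem_subset[OF assms, of u] by auto
  then show ?case
    using 1 by (metis hered.intros subset_imp_lepoll)
qed

lemma card_below_lepoll:
  assumes "regular_bound \<kappa>" "ord_below i \<kappa>" "X \<lesssim> elts i"
  shows "card_below X \<kappa>"
proof (cases \<kappa>)
  case (Cardinal l)
  then have "elts i \<prec> elts l"
    using assms by (auto simp: regular_cardinal_def cardinal_def)
  then show ?thesis
    using assms(3) Cardinal lesspoll_trans1 by auto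
next
  case Infty
  then show ?thesis using small_lepoll[OF assms(3)] by simp
qed

subsection \<open>A criterion for ghosts\<close>

text \<open>The ghost has \<open>memproj j ` X j\<close> as its component at \<open>succ j\<close>, and so its successors are the
  branches that are excluded.\<close>

lemma ghostI:
  fixes i :: "'a::zfc"
  assumes \<kappa>: "regular_bound \<kappa>" "ord_below i \<kappa>"
    and i: "limit i" "i \<noteq> vset {}"
    and card: "\<And>j. j \<in> elts i \<Longrightarrow> X j \<lesssim> elts i"
    and hered: "\<And>j x. j \<in> elts i \<Longrightarrow> x \<in> X j \<Longrightarrow> hered i x"
    and nonempty: "X (vset {}) \<noteq> {}"
    and match: "\<And>j k. \<lbrakk>j \<in> elts i; k \<in> elts i; elts k \<subseteq> elts j\<rbrakk> \<Longrightarrow> memproj k ` X k = memproj k ` X j"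
    and no_branch: "\<And>f. \<lbrakk>\<And>j. j \<in> elts i \<Longrightarrow> f j \<in> X j;
      \<And>j k. j \<in> elts i \<Longrightarrow> k \<in> elts j \<Longrightarrow> memproj k (f j) = memproj k (f k)\<rbrakk> \<Longrightarrow> False"
  shows "\<exists>a. ghost \<kappa> i a"
proof -
  note Ord_i = limit_Ord[OF i(1)]
  define r where "r j = vset (X j)" for j
  have elts_r: "elts (r j) = X j" if "j \<in> elts i" for j
    using small_lepoll[OF card[OF that]] by (simp add: r_def)
  have "hered i (r j)" if "j \<in> elts i" for j
    by (rule hered.intros) (use card hered that in \<open>auto simp: elts_r\<close>)
  then have ts: "\<exists>S R. transition_system \<kappa> S R \<and> r j \<in> elts S \<and>
      (\<forall>k. memproj k (r j) = projection R k (r j))" if "j \<in> elts i" for j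
    using that card_below_lepoll[OF \<kappa>] hered_tclosure memproj_transition_system[of "r j" \<kappa>] by metis
  define a where "a = family i (\<lambda>j. memproj j (r j))"
  have a: "component a j = memproj j (r j)" if "j \<in> elts i" for j
    using that by (simp add: a_def)
  have coalg: "coalgebraic \<kappa> j (memproj j (r j))" if "j \<in> elts i" for j
    unfolding coalgebraic_def using ts[OF that] by metis
  have lev: "memproj j (r j) \<in> level \<kappa> j" if "j \<in> elts i" for j
    using ts[OF that] projection_level Ord_mem[OF Ord_i that] by metis
  have conn: "conn j k (memproj j (r j)) = memproj k (r k)"
    if j: "j \<in> elts i" and k: "k \<in> elts (succ j)" for j k
  proof -
    have Ord: "Ord j" "Ord k" and "k \<in> elts i"
      using k Ord_mem[OF Ord_i j] Ord_mem[of j k] mem_elts_trans[OF Ord_i j] j by auto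
    moreover have "elts k \<subseteq> elts j"
      using k Ord_subset_iff Ord by blast
    ultimately have "memproj k (r j) = memproj k (r k)"
      using match[of j k] j by (intro memproj_cong) (auto simp: elts_r)
    then show ?thesis
      using conn_memproj[OF Ord(1) k] by simp
  qed
  have a_level: "a \<in> level \<kappa> i"
    unfolding level_limit[OF i(1)] a_def using lev conn by auto
  have "cauchy \<kappa> i a"
    unfolding cauchy_def using i a_level a coalg by simp
  moreover have "a \<noteq> zero_elt i"
  proof
    assume eq: "a = zero_elt i"
    \<comment> \<open>Depth one separates empty from nonempty sets, and nonemptiness passes from
      \<open>X\<close> at zero to \<open>X\<close> at one by \<open>match\<close>.\<close>
    let ?z = "succ (vset {}) :: 'a"
    have z: "?z \<in> elts i" "vset {} \<in> elts i"
      using i limit_succ_mem limit_zero_mem by auto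
    have "elts (component a ?z) = memproj (vset {}) ` X ?z"
      using z by (simp add: a elts_memproj_succ elts_r)
    then have "elts (component a ?z) \<noteq> {}"
      using match[of ?z "vset {}"] z nonempty by auto
    moreover have "component a ?z = vset {}"
      using z i by (simp add: eq zero_elt_limit zero_elt_succ)
    ultimately show False by simp
  qed
  moreover have "\<not> successor \<kappa> i a b" for b
  proof
    assume "successor \<kappa> i a b"
    then have b: "b \<in> level \<kappa> i" and mem: "\<And>j. j \<in> elts i \<Longrightarrow> component b j \<in> elts (component a (succ j))"
      by (auto simp: successor_def)
    \<comment> \<open>The component of \<open>a\<close> at \<open>succ j\<close> comes from
      \<open>X (succ j)\<close>; \<open>match\<close> at depth \<open>j\<close> moves the witness to
      \<open>X j\<close>.\<close>
    have "\<exists>x\<in>X j. component b j = memproj j x" if "j \<in> elts i" for j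
    proof -
      have "component b j \<in> memproj j ` X (succ j)"
        using mem[OF that] limit_succ_mem[OF i(1) that] by (simp add: a elts_memproj_succ elts_r)
      also have "memproj j ` X (succ j) = memproj j ` X j"
        using match[of "succ j" j] that limit_succ_mem[OF i(1) that] by auto
      finally show ?thesis by auto
    qed
    then obtain f where f: "\<And>j. j \<in> elts i \<Longrightarrow> f j \<in> X j \<and> component b j = memproj j (f j)"
      by metis
    have "memproj k (f j) = memproj k (f k)" if "j \<in> elts i" "k \<in> elts j" for j k
    proof -
      have "k \<in> elts i"
        using that mem_elts_trans Ord_i by blast
      then have "memproj k (f k) = conn j k (memproj j (f j))"
        using level_limitD(2)[OF i(1) b] f that by metis
      also have "\<dots> = memproj k (f j)"
        using conn_memproj[of j k] that Ord_mem[OF Ord_i] by simp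
      finally show ?thesis ..
    qed
    then show False
      using no_branch f by blast
  qed
  ultimately show ?thesis
    unfolding ghost_def by blast
qed

subsection \<open>Visibility\<close>

text \<open>The competitor \<open>y\<close> ranges over the whole universe, so visibility can be
  built up from elements to sets without knowing what they are compared with.\<close>

definition visible :: "'a::zfc \<Rightarrow> 'a \<Rightarrow> bool"
  where "visible j x \<longleftrightarrow> (\<forall>y. memproj j y = memproj j x \<longrightarrow> y = x)"

lemma visible_mono: "visible k x \<Longrightarrow> Ord j \<Longrightarrow> Ord k \<Longrightarrow> elts k \<subseteq> elts j \<Longrightarrow> visible j x"
  unfolding visible_def using memproj_mono by blast

lemma visible_succ: "visible k x \<Longrightarrow> Ord k \<Longrightarrow> visible (succ k) x"
  by (rule visible_mono) auto

text \<open>Depth \<open>j\<close> compares elements at depth \<open>k\<close>, where no other set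
  shares the projection of an element of \<open>x\<close>; hence \<open>y\<close> has exactly the
  elements of \<open>x\<close>.\<close>

lemma visibleI:
  assumes "Ord j" "k \<in> elts j" "\<And>u. u \<in> elts x \<Longrightarrow> visible k u"
  shows "visible j x"
  unfolding visible_def
proof (intro allI impI extensionality)
  fix y assume "memproj j y = memproj j x"
  then have eq: "memproj k ` elts y = memproj k ` elts x"
    using memproj_eq_iff assms by blast
  have *: "v = u" if "u \<in> elts x" "memproj k v = memproj k u" for u v
    using assms(3) that unfolding visible_def by blast
  show "elts y = elts x"
  proof (intro equalityI subsetI)
    fix v assume "v \<in> elts y"
    then have "memproj k v \<in> memproj k ` elts x"
      using eq by blast
    then show "v \<in> elts x"
      using * by auto
  next
    fix u assume u: "u \<in> elts x"
    then have "memproj k u \<in> memproj k ` elts y"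
      using eq by blast
    then show "u \<in> elts y"
      using *[OF u] by auto
  qed
qed

text \<open>By induction the elements of \<open>k\<close> are visible at depth \<open>k\<close>,
  hence \<open>k\<close> itself at every greater depth.\<close>

lemma visible_Ord: "Ord j \<Longrightarrow> k \<in> elts j \<Longrightarrow> visible j k"
proof (induction k arbitrary: j rule: wf_induct_rule[OF foundation])
  case (1 k)
  have "Ord k" using 1 Ord_mem by blast
  then have "visible k u" if "u \<in> elts k" for u
    using 1 that by blast
  then show ?case
    using 1 visibleI by blast
qed

text \<open>One level is spent on \<open>k\<close> and \<open>q\<close>, whose elements are visible
  at \<open>m\<close>, one on the two inner sets of the Kuratowski pair, and one on the
  pair.\<close>

lemma visible_vpair:
  assumes "Ord m" "k \<in> elts m" "elts q \<subseteq> elts m"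
  shows "visible (succ (succ (succ m))) (vpair k q)"
proof -
  have "visible m u" if "u \<in> elts m" for u
    using that assms(1) visible_Ord by blast
  then have "visible (succ m) k" "visible (succ m) q"
    using assms visible_succ by (blast, intro visibleI[of "succ m" m]) auto
  then have "visible (succ (succ m)) (vset {k})" "visible (succ (succ m)) (vset {k, q})"
    using assms by (intro visibleI[of "succ (succ m)" "succ m"]; force)+
  then show ?thesis
    using assms unfolding vpair_def
    by (intro visibleI[of "succ (succ (succ m))" "succ (succ m)"]) auto
qed

text \<open>At a depth \<open>m\<close> below \<open>j\<close>, an element of \<open>k\<close> below
  \<open>m\<close> also lies in \<open>l\<close>, and by induction any other element looks like
  \<open>m\<close>, which lies in \<open>l\<close> too.\<close>

lemma memproj_Ord_eq:
  assumes "Ord j"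
  shows "Ord k \<Longrightarrow> Ord l \<Longrightarrow> elts j \<subseteq> elts k \<Longrightarrow> elts j \<subseteq> elts l \<Longrightarrow> memproj j k = memproj j l"
  using assms
proof (induction j arbitrary: k l rule: wf_induct_rule[OF foundation])
  case (1 j)
  have "memproj m ` elts k' \<subseteq> memproj m ` elts l'"
    if m: "m \<in> elts j" and "Ord k'" "Ord l'" "elts j \<subseteq> elts k'" "elts j \<subseteq> elts l'" for m k' l'
  proof (rule image_subsetI)
    fix u assume u: "u \<in> elts k'"
    have "m \<in> elts l'" "Ord m" "Ord u"
      using u that Ord_mem by auto
    show "memproj m u \<in> memproj m ` elts l'"
    proof (cases "u \<in> elts m")
      case True
      then show ?thesis
        using \<open>m \<in> elts l'\<close> mem_elts_trans[OF \<open>Ord l'\<close>] by auto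
    next
      case False
      then have "elts m \<subseteq> elts u"
        using Ord_not_mem_iff \<open>Ord m\<close> \<open>Ord u\<close> by blast
      then have "memproj m u = memproj m m"
        using "1.IH"[of m u m] m \<open>Ord m\<close> \<open>Ord u\<close> by auto
      then show ?thesis
        using \<open>m \<in> elts l'\<close> by auto
    qed
  qed
  then show ?case
    using "1.prems" unfolding memproj_eq_iff[OF \<open>Ord j\<close>] by (meson subset_antisym)
qed

lemma memproj_vpair_cong:
  assumes "Ord j" "memproj j k = memproj j l"
  shows "memproj j (vpair k q) = memproj j (vpair l q)"
proof -
  have "memproj j (vset {k}) = memproj j (vset {l})" "memproj j (vset {k, q}) = memproj j (vset {l, q})"
    using assms by (auto intro: memproj_cong)
  then show ?thesis
    unfolding vpair_def using assms by (intro memproj_cong) auto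
qed

section \<open>States that encode sets of pairs, and the ghost criterion for them\<close>

section \<open>Ghosts from sets of pairs\<close>

text \<open>At level \<open>j\<close> the pairs \<open>(k, q)\<close> with \<open>k \<ge> j\<close> look like \<open>(i, q)\<close>.  All pairs \<open>(i, q)\<close> are included
  so that only the pairs of \<open>W\<close> below \<open>j\<close> matter at level \<open>j\<close>.\<close>

definition state :: "'a::zfc \<Rightarrow> 'a set \<Rightarrow> ('a \<times> 'a) set \<Rightarrow> 'a"
  where "state i Q W = vset ((\<lambda>(k, q). vpair k q) ` W \<union> vpair i ` Q)"

lemma state_lepoll:
  assumes "infinite (elts i)" "Q \<lesssim> elts i" "W \<subseteq> elts i \<times> Q"
  shows "(\<lambda>(k, q). vpair k q) ` W \<union> vpair i ` Q \<lesssim> elts i"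
proof (rule Un_lepoll[OF assms(1)])
  have "W \<lesssim> elts i"
    by (rule lepoll_trans[OF subset_imp_lepoll[OF assms(3)]], rule Sigma_lepoll) (use assms in auto)
  then show "(\<lambda>(k, q). vpair k q) ` W \<lesssim> elts i"
    by (rule lepoll_trans[OF image_lepoll])
  show "vpair i ` Q \<lesssim> elts i"
    using assms(2) by (rule lepoll_trans[OF image_lepoll])
qed

lemma elts_state:
  assumes "infinite (elts i)" "Q \<lesssim> elts i" "W \<subseteq> elts i \<times> Q"
  shows "elts (state i Q W) = (\<lambda>(k, q). vpair k q) ` W \<union> vpair i ` Q"
  unfolding state_def using small_lepoll[OF state_lepoll[OF assms]] by simp

lemma hered_state:
  assumes "Ord i" "infinite (elts i)" "Q \<lesssim> elts i" "W \<subseteq> elts i \<times> Q" "\<And>q. q \<in> Q \<Longrightarrow> elts q \<subseteq> elts i"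
  shows "hered i (state i Q W)"
proof (rule hered.intros)
  show "elts (state i Q W) \<lesssim> elts i"
    using elts_state state_lepoll assms by metis
  have "hered i k" if "k \<in> elts (succ i)" for k
    using that assms(1) Ord_mem_subset by (intro hered_subset_Ord) auto
  moreover have "hered i q" if "q \<in> Q" for q
    using assms that hered_subset_Ord by blast
  ultimately show "hered i u" if "u \<in> elts (state i Q W)" for u
    using that assms(2-4) by (auto simp: elts_state intro!: hered_vpair)
qed

lemma memproj_state_eq:
  assumes "Ord i" "infinite (elts i)" "Q \<lesssim> elts i" "W \<subseteq> elts i \<times> Q" "W' \<subseteq> elts i \<times> Q"
    and "j \<in> elts i" "\<And>k q. k \<in> elts j \<Longrightarrow> (k, q) \<in> W \<longleftrightarrow> (k, q) \<in> W'"
  shows "memproj j (state i Q W) = memproj j (state i Q W')"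
proof -
  have Ord_j: "Ord j"
    using assms Ord_mem by blast
  have sub: "memproj j ` elts (state i Q V) \<subseteq> memproj j ` elts (state i Q V')"
    if V: "V \<subseteq> elts i \<times> Q" "V' \<subseteq> elts i \<times> Q"
      and eq: "\<And>k q. k \<in> elts j \<Longrightarrow> (k, q) \<in> V \<Longrightarrow> (k, q) \<in> V'" for V V'
  proof (rule image_subsetI)
    fix x assume "x \<in> elts (state i Q V)"
    then consider k q where "(k, q) \<in> V" "x = vpair k q" | q where "q \<in> Q" "x = vpair i q"
      using V assms(2,3) by (auto simp: elts_state)
    then show "memproj j x \<in> memproj j ` elts (state i Q V')"
    proof cases
      case 1
      have kq: "k \<in> elts i" "q \<in> Q"
        using 1 V by auto
      show ?thesis
      proof (cases "k \<in> elts j")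
        case True
        then have "x \<in> elts (state i Q V')"
          using 1 eq V assms(2,3) by (force simp: elts_state)
        then show ?thesis by blast
      next
        case False
        have "Ord k"
          using kq assms(1) Ord_mem by blast
        then have "elts j \<subseteq> elts k"
          using False Ord_not_mem_iff[OF _ Ord_j] by blast
        then have "memproj j k = memproj j i"
          using memproj_Ord_eq[OF Ord_j \<open>Ord k\<close> assms(1)] Ord_mem_subset[OF assms(1,6)] by blast
        then have "memproj j x = memproj j (vpair i q)"
          using 1 Ord_j memproj_vpair_cong by blast
        moreover have "vpair i q \<in> elts (state i Q V')"
          using kq V assms(2,3) by (auto simp: elts_state)
        ultimately show ?thesis by blast
      qed
    next
      case 2
      then have "x \<in> elts (state i Q V')"
        using V assms(2,3) by (auto simp: elts_state)
      then show ?thesis by blast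
    qed
  qed
  show ?thesis
    by (intro memproj_cong[OF Ord_j] equalityI; rule sub) (use assms in auto)
qed

text \<open>The pair is visible three levels above \<open>m\<close>, and reading the elements of a
  state costs a fourth.\<close>

lemma memproj_state_eqD:
  assumes "infinite (elts i)" "Q \<lesssim> elts i" "W \<subseteq> elts i \<times> Q" "W' \<subseteq> elts i \<times> Q"
    and "Ord m" "k \<in> elts m" "elts q \<subseteq> elts m" "(k, q) \<in> W"
    and eq: "memproj (succ (succ (succ (succ m)))) (state i Q W) =
      memproj (succ (succ (succ (succ m)))) (state i Q W')"
  shows "(k, q) \<in> W'"
proof -
  let ?n = "succ (succ (succ m))"
  have "vpair k q \<in> elts (state i Q W)"
    using assms by (force simp: elts_state)
  then have "memproj ?n (vpair k q) \<in> memproj ?n ` elts (state i Q W')"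
    using eq elts_memproj_succ by (metis image_eqI)
  then have "vpair k q \<in> elts (state i Q W')"
    using visible_vpair[OF assms(5-7)] unfolding visible_def by auto
  \<comment> \<open>The added pairs all have first coordinate \<open>i\<close>, so the pair found
    belongs to \<open>W'\<close>.\<close>
  moreover have "k \<noteq> i"
    using assms(3,8) by auto
  ultimately show ?thesis
    using assms(1-4) by (auto simp: elts_state)
qed

text \<open>This restates \<open>ghostI\<close> in terms of pairs. Along a branch, membership of the
  pairs in a window, those with \<open>k\<close> below \<open>m\<close> and \<open>q\<close> a
  subset of \<open>m\<close>, is constant from four levels above \<open>m\<close> on.\<close>

lemma ghost_of_pairs:
  fixes i :: "'a::zfc" and N :: "'a \<Rightarrow> ('a \<times> 'a) set set"
  assumes \<kappa>: "regular_bound \<kappa>" "ord_below i \<kappa>"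
    and i: "limit i" "i \<noteq> vset {}"
    and Q: "Q \<lesssim> elts i" "\<And>q. q \<in> Q \<Longrightarrow> elts q \<subseteq> elts i"
    and N_subset: "\<And>j W. j \<in> elts i \<Longrightarrow> W \<in> N j \<Longrightarrow> W \<subseteq> elts i \<times> Q"
    and N_card: "\<And>j. j \<in> elts i \<Longrightarrow> N j \<lesssim> elts i"
    and N_nonempty: "N (vset {}) \<noteq> {}"
    and N_antimono: "\<And>j k. \<lbrakk>j \<in> elts i; k \<in> elts i; elts k \<subseteq> elts j\<rbrakk> \<Longrightarrow> N j \<subseteq> N k"
    and N_extend: "\<And>j k W. \<lbrakk>j \<in> elts i; k \<in> elts i; elts k \<subseteq> elts j; W \<in> N k\<rbrakk> \<Longrightarrow>
      \<exists>W'\<in>N j. \<forall>l\<in>elts k. \<forall>q. (l, q) \<in> W' \<longleftrightarrow> (l, q) \<in> W"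
    and no_branch: "\<And>f. \<lbrakk>\<And>j. j \<in> elts i \<Longrightarrow> f j \<in> N j;
      \<And>m. m \<in> elts i \<Longrightarrow> \<exists>n\<in>elts i. \<forall>j\<in>elts i. elts n \<subseteq> elts j \<longrightarrow>
        (\<forall>k\<in>elts m. \<forall>q. elts q \<subseteq> elts m \<longrightarrow> ((k, q) \<in> f j \<longleftrightarrow> (k, q) \<in> f n))\<rbrakk> \<Longrightarrow> False"
  shows "\<exists>a. ghost \<kappa> i a"
proof (rule ghostI[where X = "\<lambda>j. state i Q ` N j", OF \<kappa> i])
  note Ord_i = limit_Ord[OF i(1)] and inf = infinite_limit[OF i]
  show "state i Q ` N j \<lesssim> elts i" if "j \<in> elts i" for j
    using N_card[OF that] by (rule lepoll_trans[OF image_lepoll])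
  show "hered i x" if "j \<in> elts i" "x \<in> state i Q ` N j" for j x
    using that N_subset Q by (auto intro!: hered_state[OF Ord_i inf])
  show "state i Q ` N (vset {}) \<noteq> {}"
    using N_nonempty by simp
  show "memproj k ` state i Q ` N k = memproj k ` state i Q ` N j"
    if jk: "j \<in> elts i" "k \<in> elts i" "elts k \<subseteq> elts j" for j k
  proof
    show "memproj k ` state i Q ` N j \<subseteq> memproj k ` state i Q ` N k"
      using N_antimono[OF jk] by blast
    show "memproj k ` state i Q ` N k \<subseteq> memproj k ` state i Q ` N j"
    proof
      fix x assume "x \<in> memproj k ` state i Q ` N k"
      then obtain W where W: "W \<in> N k" "x = memproj k (state i Q W)"
        by blast
      then obtain W' where W': "W' \<in> N j" "\<forall>l\<in>elts k. \<forall>q. (l, q) \<in> W' \<longleftrightarrow> (l, q) \<in> W"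
        using N_extend[OF jk] by blast
      then have "memproj k (state i Q W) = memproj k (state i Q W')"
        using W jk N_subset by (intro memproj_state_eq[OF Ord_i inf Q(1)]) auto
      then show "x \<in> memproj k ` state i Q ` N j"
        using W W' by blast
    qed
  qed
  fix g
  assume g: "\<And>j. j \<in> elts i \<Longrightarrow> g j \<in> state i Q ` N j"
    and coherent: "\<And>j k. j \<in> elts i \<Longrightarrow> k \<in> elts j \<Longrightarrow> memproj k (g j) = memproj k (g k)"
  from g have "\<exists>W. W \<in> N j \<and> g j = state i Q W" if "j \<in> elts i" for j
    using that by blast
  then obtain f where f: "\<And>j. j \<in> elts i \<Longrightarrow> f j \<in> N j" "\<And>j. j \<in> elts i \<Longrightarrow> g j = state i Q (f j)"
    by metis
  show False
  proof (rule no_branch[OF f(1)])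
    fix m assume m: "m \<in> elts i"
    let ?n = "succ (succ (succ (succ m)))"
    have n: "?n \<in> elts i"
      using m i limit_succ_mem by blast
    have "(k, q) \<in> f j \<longleftrightarrow> (k, q) \<in> f ?n"
      if j: "j \<in> elts i" "elts ?n \<subseteq> elts j" and kq: "k \<in> elts m" "elts q \<subseteq> elts m" for j k q
    proof -
      have "?n \<in> elts (succ j)"
        using Ord_subset_iff j n Ord_i Ord_mem by blast
      then have "memproj ?n (state i Q (f j)) = memproj ?n (state i Q (f ?n))"
        using coherent[OF j(1), of ?n] f(2)[OF j(1)] f(2)[OF n] by auto
      then show ?thesis
        using memproj_state_eqD[OF inf Q(1) _ _ Ord_mem[OF Ord_i m] kq]
          N_subset f(1) j(1) n by metis
    qed
    then show "\<exists>n\<in>elts i. \<forall>j\<in>elts i. elts n \<subseteq> elts j \<longrightarrow>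
        (\<forall>k\<in>elts m. \<forall>q. elts q \<subseteq> elts m \<longrightarrow> ((k, q) \<in> f j \<longleftrightarrow> (k, q) \<in> f n))"
      using n by blast
  qed
qed

section \<open>The case without the tree property\<close>

section \<open>Trees without a full branch\<close>

text \<open>A coherent choice of paths settles on one node at each level, and these nodes would form
  a full branch of the tree.\<close>

lemma ghost_of_tree:
  fixes i :: "'a::zfc"
  assumes \<kappa>: "regular_bound \<kappa>" "ord_below i \<kappa>"
    and i: "limit i" "i \<noteq> vset {}"
    and "\<not> tree_property i"
  shows "\<exists>a. ghost \<kappa> i a"
proof -
  note Ord_i = limit_Ord[OF i(1)] and inf = infinite_limit[OF i]
  obtain D d where tidy: "tidy_tree i D d" and card: "\<And>k. k \<in> elts i \<Longrightarrow> elts (D k) \<prec> elts i"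
    and no_full_branch: "\<nexists>b. full_branch D d (elts i) b"
    using assms(5) unfolding tree_property_def by blast
  have "\<forall>j\<in>elts i. \<forall>k\<in>elts (succ j). \<forall>l\<in>elts (succ k). \<forall>x\<in>elts (D j). d k l (d j k x) = d j l x"
    using tidy unfolding tidy_tree_def inverse_system_def by (elim conjE)
  then have d_comp: "d k l (d j k x) = d j l x"
    if "j \<in> elts i" "k \<in> elts (succ j)" "l \<in> elts (succ k)" "x \<in> elts (D j)" for j k l x
    using that by (simp del: elts_succ)
  have "\<forall>j\<in>elts i. \<forall>k\<in>elts (succ j). d j k ` elts (D j) = elts (D k)"
    using tidy unfolding tidy_tree_def by (elim conjE)
  then have d_surj: "d j k ` elts (D j) = elts (D k)" if "j \<in> elts i" "k \<in> elts (succ j)" for j k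
    using that by (simp del: elts_succ)
  obtain x0 where x0: "elts (D (vset {})) = {x0}"
    using tidy by (auto simp only: tidy_tree_def)
  \<comment> \<open>Nodes are coded by ordinals, with one bound \<open>t k\<close> below
    \<open>i\<close> for a whole level, so that a single window holds all codes of that
    level.\<close>
  have "\<exists>t c. t \<in> elts i \<and> inj_on c (elts (D k)) \<and> c ` elts (D k) \<subseteq> elts t" if "k \<in> elts i" for k
    using lesspoll_Ord[OF Ord_i card[OF that]] unfolding lepoll_def by metis
  then obtain t c where t: "\<And>k. k \<in> elts i \<Longrightarrow> t k \<in> elts i"
    and c_inj: "\<And>k. k \<in> elts i \<Longrightarrow> inj_on (c k) (elts (D k))"
    and c: "\<And>k. k \<in> elts i \<Longrightarrow> c k ` elts (D k) \<subseteq> elts (t k)"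
    by metis
  define W where "W j x = {(k, c k (d j k x)) |k. k \<in> elts (succ j)}" for j x
  define N where "N j = {W l x |l x. l \<in> elts i \<and> elts j \<subseteq> elts l \<and> x \<in> elts (D l)}" for j
  have W_iff: "(k, q) \<in> W j x \<longleftrightarrow> k \<in> elts (succ j) \<and> q = c k (d j k x)" for k q j x
    unfolding W_def by blast
  have c_mem: "c k (d j k x) \<in> elts (t k)"
    if "j \<in> elts i" "k \<in> elts (succ j)" "x \<in> elts (D j)" for j k x
  proof -
    have "k \<in> elts i"
      using that mem_elts_trans[OF Ord_i] by auto
    then show ?thesis
      using c[of k] d_surj[OF that(1,2)] that(3) by blast
  qed
  have W_subset: "W j x \<subseteq> elts i \<times> elts i" if "j \<in> elts i" "x \<in> elts (D j)" for j x
  proof -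
    have "k \<in> elts i \<and> c k (d j k x) \<in> elts i" if "k \<in> elts (succ j)" for k
    proof -
      have "k \<in> elts i"
        using that \<open>j \<in> elts i\<close> mem_elts_trans[OF Ord_i] by auto
      then show ?thesis
        using c_mem[OF \<open>j \<in> elts i\<close> that \<open>x \<in> elts (D j)\<close>] t mem_elts_trans[OF Ord_i] by blast
    qed
    then show ?thesis
      unfolding W_def by blast
  qed
  show ?thesis
  proof (rule ghost_of_pairs[where N = N and Q = "elts i", OF \<kappa> i])
    show "elts i \<lesssim> elts i" by simp
    show "elts q \<subseteq> elts i" if "q \<in> elts i" for q
      using that Ord_mem_subset[OF Ord_i] by simp
    show "V \<subseteq> elts i \<times> elts i" if "j \<in> elts i" "V \<in> N j" for j V
      using that W_subset unfolding N_def by blast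
    show "N j \<lesssim> elts i" for j
    proof -
      have "N j \<subseteq> (\<lambda>(l, x). W l x) ` (SIGMA l:elts i. elts (D l))"
        unfolding N_def by auto
      moreover have "(SIGMA l:elts i. elts (D l)) \<lesssim> elts i"
        by (rule Sigma_lepoll[OF inf]) (use card lesspoll_imp_lepoll in auto)
      ultimately show ?thesis
        by (rule lepoll_trans[OF subset_image_lepoll])
    qed
    show "N (vset {}) \<noteq> {}"
      unfolding N_def using x0 limit_zero_mem[OF i] by auto
    show "N j \<subseteq> N k" if "elts k \<subseteq> elts j" for j k
      unfolding N_def using that by blast
    show "\<exists>V'\<in>N j. \<forall>l\<in>elts k. \<forall>q. (l, q) \<in> V' \<longleftrightarrow> (l, q) \<in> V"
      if j: "j \<in> elts i" and k: "k \<in> elts i" "elts k \<subseteq> elts j" and V: "V \<in> N k" for j k V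
    proof -
      obtain n x where n: "n \<in> elts i" "elts k \<subseteq> elts n" "x \<in> elts (D n)" and V: "V = W n x"
        using V unfolding N_def by blast
      show ?thesis
      proof (cases "elts j \<subseteq> elts n")
        case True
        then have "V \<in> N j"
          unfolding N_def V using n by blast
        then show ?thesis by blast
      next
        \<comment> \<open>The node lies below level \<open>j\<close>; surjectivity of the connecting
          maps supplies a node over it at level \<open>j\<close>, whose path prolongs the given
          one.\<close>
        case False
        then have nj: "n \<in> elts (succ j)"
          using Ord_subset_linear[of n j] Ord_subset_iff[of n j] Ord_mem[OF Ord_i j]
            Ord_mem[OF Ord_i n(1)] by blast
        then obtain x' where x': "x' \<in> elts (D j)" "x = d j n x'"
          using d_surj[OF j nj] n by blast
        have "(l, q) \<in> W j x' \<longleftrightarrow> (l, q) \<in> V" if "l \<in> elts k" for l q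
        proof -
          have "l \<in> elts (succ n)" "l \<in> elts (succ j)"
            using that n k by auto
          then show ?thesis
            using d_comp[OF j nj _ x'(1), of l] by (simp add: V W_iff x')
        qed
        moreover have "W j x' \<in> N j"
          unfolding N_def using j x' by blast
        ultimately show ?thesis by blast
      qed
    qed
    fix f
    assume f: "\<And>j. j \<in> elts i \<Longrightarrow> f j \<in> N j"
      and stable: "\<And>m. m \<in> elts i \<Longrightarrow> \<exists>n\<in>elts i. \<forall>j\<in>elts i. elts n \<subseteq> elts j \<longrightarrow>
        (\<forall>k\<in>elts m. \<forall>q. elts q \<subseteq> elts m \<longrightarrow> ((k, q) \<in> f j \<longleftrightarrow> (k, q) \<in> f n))"
    have "\<exists>l x. l \<in> elts i \<and> elts j \<subseteq> elts l \<and> x \<in> elts (D l) \<and> f j = W l x" if "j \<in> elts i" for j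
      using f[OF that] unfolding N_def by blast
    then obtain l x where l: "\<And>j. j \<in> elts i \<Longrightarrow> l j \<in> elts i" "\<And>j. j \<in> elts i \<Longrightarrow> elts j \<subseteq> elts (l j)"
      and x: "\<And>j. j \<in> elts i \<Longrightarrow> x j \<in> elts (D (l j))" and fW: "\<And>j. j \<in> elts i \<Longrightarrow> f j = W (l j) (x j)"
      by metis
    have le: "k \<in> elts (succ (l j))" if "j \<in> elts i" "k \<in> elts i" "elts k \<subseteq> elts j" for j k
      using that l[of j] Ord_subset_iff[of k "l j"] Ord_mem[OF Ord_i] by blast
    \<comment> \<open>\<open>z\<close> is the eventual ancestor at level \<open>k\<close> of the
      nodes \<open>x j\<close>; taking \<open>J\<close> at least \<open>k\<close> ensures that these
      nodes reach level \<open>k\<close>.\<close>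
    have "\<exists>z J. J \<in> elts i \<and> elts k \<subseteq> elts J \<and> z \<in> elts (D k) \<and>
        (\<forall>j\<in>elts i. elts J \<subseteq> elts j \<longrightarrow> d (l j) k (x j) = z)" if k: "k \<in> elts i" for k
    proof -
      \<comment> \<open>The window has to contain \<open>k\<close> itself and all codes of level
        \<open>k\<close>.\<close>
      obtain m where m: "m \<in> elts i" "elts (succ k) \<subseteq> elts m" "elts (t k) \<subseteq> elts m"
        using limit_max_mem[OF i(1) limit_succ_mem[OF i(1) k] t[OF k]] .
      obtain n where n: "n \<in> elts i" and eq: "\<And>j k q. \<lbrakk>j \<in> elts i; elts n \<subseteq> elts j; k \<in> elts m;
          elts q \<subseteq> elts m\<rbrakk> \<Longrightarrow> (k, q) \<in> f j \<longleftrightarrow> (k, q) \<in> f n"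
        using stable[OF m(1)] by metis
      obtain J where J: "J \<in> elts i" "elts k \<subseteq> elts J" "elts n \<subseteq> elts J"
        using limit_max_mem[OF i(1) k n] .
      have "d (l j) k (x j) = d (l J) k (x J)" if j: "j \<in> elts i" "elts J \<subseteq> elts j" for j
      proof -
        let ?q = "c k (d (l j) k (x j))"
        have lj: "k \<in> elts (succ (l j))" and lJ: "k \<in> elts (succ (l J))"
          using le k j J by blast+
        have "?q \<in> elts m"
          using c_mem[OF l(1)[OF j(1)] lj x[OF j(1)]] m by blast
        then have "elts ?q \<subseteq> elts m"
          using Ord_mem_subset Ord_mem[OF Ord_i m(1)] by blast
        moreover have "(k, ?q) \<in> f j"
          using fW[OF j(1)] lj W_iff by simp
        ultimately have "(k, ?q) \<in> f J"
          using eq[of j k ?q] eq[of J k ?q] j J m by auto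
        then have "?q = c k (d (l J) k (x J))"
          using fW[OF J(1)] W_iff by simp
        moreover have "d (l j) k (x j) \<in> elts (D k)" "d (l J) k (x J) \<in> elts (D k)"
          using d_surj[OF l(1) lj] d_surj[OF l(1) lJ] x j J by blast+
        ultimately show ?thesis
          using c_inj[OF k] by (meson inj_onD)
      qed
      moreover have "d (l J) k (x J) \<in> elts (D k)"
        using d_surj[OF l(1)[OF J(1)] le[OF J(1) k J(2)]] x[OF J(1)] by blast
      ultimately show ?thesis
        using J by blast
    qed
    then obtain z J where J: "\<And>k. k \<in> elts i \<Longrightarrow> J k \<in> elts i" "\<And>k. k \<in> elts i \<Longrightarrow> elts k \<subseteq> elts (J k)"
      and z: "\<And>k. k \<in> elts i \<Longrightarrow> z k \<in> elts (D k)"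
      and zJ: "\<And>k j. \<lbrakk>k \<in> elts i; j \<in> elts i; elts (J k) \<subseteq> elts j\<rbrakk> \<Longrightarrow> d (l j) k (x j) = z k"
      by metis
    have "full_branch D d (elts i) z"
      unfolding full_branch_def
    proof (intro conjI ballI impI)
      fix k k' assume k: "k \<in> elts i" and k': "k' \<in> elts i" "k' \<in> elts (succ k)"
      \<comment> \<open>Far enough out, \<open>z k\<close> and \<open>z k'\<close> are ancestors of
        the same node \<open>x j\<close>.\<close>
      obtain j where j: "j \<in> elts i" "elts (J k) \<subseteq> elts j" "elts (J k') \<subseteq> elts j"
        using limit_max_mem[OF i(1) J(1)[OF k] J(1)[OF k'(1)]] .
      have "k \<in> elts (succ (l j))"
        using le k j J(2)[OF k] by blast
      then have "d k k' (d (l j) k (x j)) = d (l j) k' (x j)"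
        using d_comp[OF l(1)[OF j(1)] _ k'(2) x[OF j(1)]] by blast
      then show "d k k' (z k) = z k'"
        using zJ k k' j by simp
    qed (use z in auto)
    then show False
      using no_full_branch by blast
  qed
qed

section \<open>The case that is not strongly inaccessible\<close>

section \<open>Increasing finite sequences\<close>

text \<open>\<open>chain \<psi> L W x\<close>: there are \<open>0 = x\<^sub>0 < x\<^sub>1 < \<dots> < x\<^sub>n = x\<close> with \<open>n > 0\<close>, the terms other than \<open>x\<^sub>0\<close> in \<open>L\<close>,
  and \<open>W\<close> consists of the pairs \<open>(x\<^sub>k, \<psi> x\<^bsub>k+1\<^esub>)\<close>.\<close>

inductive chain :: "('a::zfc \<Rightarrow> 'a) \<Rightarrow> 'a set \<Rightarrow> ('a \<times> 'a) set \<Rightarrow> 'a \<Rightarrow> bool" for \<psi> L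
  where init: "x \<in> L \<Longrightarrow> vset {} \<in> elts x \<Longrightarrow> chain \<psi> L {(vset {}, \<psi> x)} x"
  | step: "chain \<psi> L W x \<Longrightarrow> y \<in> L \<Longrightarrow> x \<in> elts y \<Longrightarrow> chain \<psi> L (insert (x, \<psi> y) W) y"

lemma chain_finite: "chain \<psi> L W x \<Longrightarrow> finite W"
  by (induction rule: chain.induct) auto

lemma chain_last: "chain \<psi> L W x \<Longrightarrow> x \<in> L"
  by (induction rule: chain.induct) auto

lemma chain_subset: "chain \<psi> L W x \<Longrightarrow> W \<subseteq> insert (vset {}) L \<times> \<psi> ` L"
  by (induction rule: chain.induct) (auto dest: chain_last)

text \<open>Injectivity of \<open>\<psi>\<close> lets a code in \<open>W\<close> be recognised as
  that of a term, so what follows \<open>z\<close> can be read off the unordered set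
  \<open>W\<close>.\<close>

lemma chain_next:
  assumes "chain \<psi> L W x" "inj_on \<psi> L"
  shows "z = vset {} \<or> z \<in> L \<and> (\<exists>k. (k, \<psi> z) \<in> W) \<Longrightarrow> z \<noteq> x \<Longrightarrow> \<exists>y\<in>L. z \<in> elts y \<and> (z, \<psi> y) \<in> W"
  using assms(1)
proof (induction arbitrary: z rule: chain.induct)
  case (init x)
  then show ?case
    using assms(2) by (auto dest: inj_onD)
next
  case (step W x y)
  show ?case
  proof (cases "z = x")
    case True
    then show ?thesis using step by auto
  next
    case False
    have "z = vset {} \<or> z \<in> L \<and> (\<exists>k. (k, \<psi> z) \<in> W)"
      using step.prems step.hyps assms(2) by (auto dest: inj_onD)
    then show ?thesis
      using step.IH False by blast
  qed
qed

text \<open>A chain is prolonged past any level by one pair whose first coordinate is its last term,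
  so nothing below that term changes. As all codes are subsets of one \<open>t\<close>, a pair
  \<open>(z, \<psi> y)\<close> lies in a window once \<open>z\<close> and \<open>t\<close> fit,
  however large \<open>y\<close> is.\<close>

lemma ghost_of_chains:
  fixes i :: "'a::zfc"
  assumes \<kappa>: "regular_bound \<kappa>" "ord_below i \<kappa>"
    and i: "limit i" "i \<noteq> vset {}" "\<not> omega_cofinal i"
    and t: "t \<in> elts i"
    and L: "L \<subseteq> elts i" "\<And>j. j \<in> elts i \<Longrightarrow> \<exists>x\<in>L. j \<in> elts x" "L \<lesssim> Pow (elts t)"
  shows "\<exists>a. ghost \<kappa> i a"
proof -
  note Ord_i = limit_Ord[OF i(1)] and inf = infinite_limit[OF i(1,2)]
  have Ord_L: "Ord x" if "x \<in> L" for x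
    using that L(1) Ord_mem[OF Ord_i] by blast
  obtain \<phi> where \<phi>: "inj_on \<phi> L" "\<phi> ` L \<subseteq> Pow (elts t)"
    using L(3) unfolding lepoll_def by blast
  define \<psi> where "\<psi> x = vset (\<phi> x)" for x
  have elts_\<psi>: "elts (\<psi> x) = \<phi> x" if "x \<in> L" for x
    using \<phi> that small_subset[OF small_elts[of t]] by (auto simp: \<psi>_def)
  have \<psi>_inj: "inj_on \<psi> L"
    using \<phi>(1) elts_\<psi> by (metis inj_on_def)
  have \<psi>_subset: "elts (\<psi> x) \<subseteq> elts t" if "x \<in> L" for x
    using that \<phi>(2) elts_\<psi> by blast
  define N where "N j = {W. \<exists>x. chain \<psi> L W x \<and> elts j \<subseteq> elts x}" for j
  have zero: "vset {} \<in> elts i"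
    using limit_zero_mem[OF i(1,2)] .
  have Q: "\<psi> ` L \<lesssim> elts i"
    by (rule lepoll_trans[OF image_lepoll subset_imp_lepoll[OF L(1)]])
  have chain_subset_i: "W \<subseteq> elts i \<times> \<psi> ` L" if "chain \<psi> L W x" for W x
    using chain_subset[OF that] zero L(1) by blast
  show ?thesis
  proof (rule ghost_of_pairs[where N = N and Q = "\<psi> ` L", OF \<kappa> i(1,2) Q])
    show "elts q \<subseteq> elts i" if "q \<in> \<psi> ` L" for q
      using that \<psi>_subset Ord_mem_subset[OF Ord_i t] by blast
    show "W \<subseteq> elts i \<times> \<psi> ` L" if "W \<in> N j" for j W
      using that chain_subset_i unfolding N_def by blast
    show "N j \<lesssim> elts i" for j
    proof -
      have "N j \<subseteq> Fpow (elts i \<times> \<psi> ` L)"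
        unfolding N_def Fpow_def using chain_subset_i chain_finite by blast
      moreover have "Fpow (elts i \<times> \<psi> ` L) \<lesssim> elts i"
        by (intro Fpow_lepoll[OF inf] Sigma_lepoll[OF inf]) (use Q in auto)
      ultimately show ?thesis
        by (rule lepoll_trans[OF subset_imp_lepoll])
    qed
    show "N (vset {}) \<noteq> {}"
      unfolding N_def using L(2)[OF zero] chain.init[of _ L \<psi>] by auto
    show "N j \<subseteq> N k" if "elts k \<subseteq> elts j" for j k
      unfolding N_def using that by blast
    show "\<exists>W'\<in>N j. \<forall>l\<in>elts k. \<forall>q. (l, q) \<in> W' \<longleftrightarrow> (l, q) \<in> W"
      if j: "j \<in> elts i" and k: "k \<in> elts i" and W: "W \<in> N k" for j k W
    proof -
      obtain x where x: "chain \<psi> L W x" "elts k \<subseteq> elts x"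
        using W unfolding N_def by blast
      have "x \<in> elts i"
        using chain_last[OF x(1)] L(1) by blast
      then obtain m where m: "m \<in> elts i" "elts x \<subseteq> elts m" "elts j \<subseteq> elts m"
        using limit_max_mem[OF i(1) _ j] by metis
      obtain y where y: "y \<in> L" "m \<in> elts y"
        using L(2)[OF m(1)] by blast
      have "x \<in> elts (succ m)"
        using m Ord_subset_iff Ord_mem[OF Ord_i] \<open>x \<in> elts i\<close> by blast
      then have "x \<in> elts y"
        using y mem_elts_trans[OF Ord_L] by auto
      then have "chain \<psi> L (insert (x, \<psi> y) W) y"
        using chain.step x y by blast
      moreover have "elts j \<subseteq> elts y"
        using m y Ord_mem_subset[OF Ord_L] by blast
      ultimately have "insert (x, \<psi> y) W \<in> N j"
        unfolding N_def by blast
      moreover have "\<forall>l\<in>elts k. \<forall>q. (l, q) \<in> insert (x, \<psi> y) W \<longleftrightarrow> (l, q) \<in> W"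
        using x(2) by auto
      ultimately show ?thesis by (rule bexI[rotated])
    qed
    fix f
    assume f: "\<And>j. j \<in> elts i \<Longrightarrow> f j \<in> N j"
      and stable: "\<And>m. m \<in> elts i \<Longrightarrow> \<exists>n\<in>elts i. \<forall>j\<in>elts i. elts n \<subseteq> elts j \<longrightarrow>
        (\<forall>k\<in>elts m. \<forall>q. elts q \<subseteq> elts m \<longrightarrow> ((k, q) \<in> f j \<longleftrightarrow> (k, q) \<in> f n))"
    \<comment> \<open>The limit of the branch: the pairs that eventually stay in \<open>f j\<close>.
      The terms it reaches are singled out by \<open>good\<close>.\<close>
    define limp where "limp k q \<longleftrightarrow> (\<exists>J\<in>elts i. \<forall>j\<in>elts i. elts J \<subseteq> elts j \<longrightarrow> (k, q) \<in> f j)" for k q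
    define good where "good z \<longleftrightarrow> z \<in> elts i \<and> (z = vset {} \<or> z \<in> L \<and> (\<exists>k. limp k (\<psi> z)))" for z
    have step: "\<exists>y. good y \<and> z \<in> elts y \<and> y \<in> L \<and> limp z (\<psi> y)" if "good z" for z
    proof -
      have z: "z \<in> elts i"
        using that good_def by blast
      obtain m where m: "m \<in> elts i" "elts (succ z) \<subseteq> elts m" "elts t \<subseteq> elts m"
        using limit_max_mem[OF i(1) limit_succ_mem[OF i(1) z] t] .
      obtain n where n: "n \<in> elts i" and eq: "\<And>j k q. \<lbrakk>j \<in> elts i; elts n \<subseteq> elts j; k \<in> elts m;
          elts q \<subseteq> elts m\<rbrakk> \<Longrightarrow> (k, q) \<in> f j \<longleftrightarrow> (k, q) \<in> f n"
        using stable[OF m(1)] by metis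
      have "\<exists>J\<in>elts i. z = vset {} \<or> z \<in> L \<and> (\<exists>k. \<forall>j\<in>elts i. elts J \<subseteq> elts j \<longrightarrow> (k, \<psi> z) \<in> f j)"
        using that zero unfolding good_def limp_def by blast
      then obtain J where J: "J \<in> elts i"
        "z = vset {} \<or> z \<in> L \<and> (\<exists>k. \<forall>j\<in>elts i. elts J \<subseteq> elts j \<longrightarrow> (k, \<psi> z) \<in> f j)"
        by blast
      obtain j' where j': "j' \<in> elts i" "elts n \<subseteq> elts j'" "elts J \<subseteq> elts j'"
        using limit_max_mem[OF i(1) n J(1)] .
      \<comment> \<open>Choosing \<open>j\<close> above \<open>z\<close> makes the chain of
        \<open>f j\<close> end beyond \<open>z\<close>, so \<open>z\<close> is not its last
        term.\<close>
      obtain j where j: "j \<in> elts i" "elts (succ z) \<subseteq> elts j" "elts j' \<subseteq> elts j"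
        using limit_max_mem[OF i(1) limit_succ_mem[OF i(1) z] j'(1)] .
      obtain x where x: "chain \<psi> L (f j) x" "elts j \<subseteq> elts x"
        using f[OF j(1)] unfolding N_def by blast
      have "z \<noteq> x"
        using j(2) x(2) by auto
      then obtain y where y: "y \<in> L" "z \<in> elts y" "(z, \<psi> y) \<in> f j"
        using chain_next[OF x(1) \<psi>_inj, of z] J(2) j j' by blast
      have "z \<in> elts m" "elts (\<psi> y) \<subseteq> elts m"
        using m \<psi>_subset[OF y(1)] by auto
      then have "(z, \<psi> y) \<in> f j''" if "j'' \<in> elts i" "elts n \<subseteq> elts j''" for j''
        using eq[of j z "\<psi> y"] eq[of j'' z "\<psi> y"] that j j' y(3) by blast
      then have "limp z (\<psi> y)"
        unfolding limp_def using n by blast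
      moreover have "y \<in> elts i"
        using y L(1) by blast
      ultimately show ?thesis
        unfolding good_def using y by blast
    qed
    have "\<exists>s. \<forall>n. good (s n) \<and> (s n \<in> elts (s (Suc n)) \<and> s (Suc n) \<in> L \<and> limp (s n) (\<psi> (s (Suc n))))"
    proof (rule dependent_nat_choice)
      show "\<exists>z. good z"
        using zero unfolding good_def by blast
    qed (use step in blast)
    then obtain s where s: "\<And>n. s n \<in> elts i" "\<And>n. s n \<in> elts (s (Suc n))" "\<And>n. s (Suc n) \<in> L"
      "\<And>n. limp (s n) (\<psi> (s (Suc n)))"
      unfolding good_def by blast
    \<comment> \<open>As \<open>i\<close> is not \<omega>-cofinal, the sequence is bounded below
      \<open>i\<close>; one window then captures all its pairs, and a single finite
      \<open>f n\<close> contains them.\<close>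
    obtain m0 where m0: "m0 \<in> elts i" "\<And>n :: nat. elts (s n) \<subseteq> elts m0"
      using not_omega_cofinal_bounded[where s = s, OF Ord_i i(3) s(1,2)] by blast
    obtain m where m: "m \<in> elts i" "elts m0 \<subseteq> elts m" "elts t \<subseteq> elts m"
      using limit_max_mem[OF i(1) m0(1) t] .
    obtain n where n: "n \<in> elts i" and eq: "\<And>j k q. \<lbrakk>j \<in> elts i; elts n \<subseteq> elts j; k \<in> elts m;
        elts q \<subseteq> elts m\<rbrakk> \<Longrightarrow> (k, q) \<in> f j \<longleftrightarrow> (k, q) \<in> f n"
      using stable[OF m(1)] by metis
    have "(s r, \<psi> (s (Suc r))) \<in> f n" for r
    proof -
      obtain J where J: "J \<in> elts i" "\<And>j. \<lbrakk>j \<in> elts i; elts J \<subseteq> elts j\<rbrakk> \<Longrightarrow> (s r, \<psi> (s (Suc r))) \<in> f j"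
        using s(4)[of r] unfolding limp_def by blast
      obtain j where j: "j \<in> elts i" "elts n \<subseteq> elts j" "elts J \<subseteq> elts j"
        using limit_max_mem[OF i(1) n J(1)] .
      have "s r \<in> elts m" "elts (\<psi> (s (Suc r))) \<subseteq> elts m"
        using m m0(2)[of "Suc r"] s(2)[of r] \<psi>_subset[OF s(3)[of r]] by auto
      then show ?thesis
        using eq J(2) j by blast
    qed
    then have "range s \<subseteq> fst ` f n"
      by force
    moreover have "finite (f n)"
      using f[OF n] chain_finite unfolding N_def by blast
    ultimately have "finite (range s)"
      using finite_surj by blast
    moreover have "s a \<in> elts (s b)" if "a < b" for a b
      using that
    proof (induction b)
      case (Suc b)
      then show ?case
        using s(2)[of b] mem_elts_trans[OF Ord_mem[OF Ord_i s(1)[of "Suc b"]]] by (auto simp: less_Suc_eq)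
    qed simp
    then have "inj s"
      by (intro linorder_injI) (metis mem_irrefl)
    ultimately show False
      using range_inj_infinite by blast
  qed
qed

text \<open>If \<open>i\<close> is not a cardinal or violates the power set condition,
  \<open>L\<close> is all of \<open>i\<close>; if \<open>i\<close> is singular, \<open>L\<close> is
  a short unbounded subset. \<open>lesspoll_Ord\<close> replaces a smaller set by an ordinal
  \<open>t\<close> below \<open>i\<close>.\<close>

lemma not_strongly_inaccessible_cofinal:
  fixes i :: "'a::zfc"
  assumes i: "limit i" "i \<noteq> vset {}" and "\<not> strongly_inaccessible i"
  obtains t L where "t \<in> elts i" "L \<subseteq> elts i" "\<And>j. j \<in> elts i \<Longrightarrow> \<exists>x\<in>L. j \<in> elts x" "L \<lesssim> Pow (elts t)"
proof -
  note Ord_i = limit_Ord[OF i(1)]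
  have unbounded: "\<exists>x\<in>elts i. j \<in> elts x" if "j \<in> elts i" for j
    using limit_succ_mem[OF i(1) that] by force
  consider (not_cardinal) "\<not> cardinal i"
    | (singular) X where "X \<subseteq> elts i" "X \<prec> elts i" "\<And>j. j \<in> elts i \<Longrightarrow> \<exists>x\<in>X. x \<notin> elts j"
    | (power) A :: 'a where "elts A \<prec> elts i" "\<not> Pow (elts A) \<prec> elts i"
  proof (cases "regular_cardinal i")
    case True
    then show ?thesis
      using assms(3) power unfolding strongly_inaccessible_def by blast
  next
    case False
    then have "\<not> (\<forall>X. X \<subseteq> elts i \<and> X \<prec> elts i \<longrightarrow> (\<exists>j\<in>elts i. \<forall>x\<in>X. x \<in> elts j))" if "cardinal i"
      using that infinite_limit[OF i] by (simp add: regular_cardinal_def)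
    then show ?thesis
      using not_cardinal singular by metis
  qed
  then show thesis
  proof cases
    case not_cardinal
    then obtain j where j: "j \<in> elts i" "\<not> elts j \<prec> elts i"
      using Ord_i unfolding cardinal_def by blast
    moreover have "elts j \<lesssim> elts i"
      using Ord_mem_subset[OF Ord_i j(1)] subset_imp_lepoll by blast
    ultimately have "elts i \<lesssim> elts j"
      using lesspoll_def eqpoll_sym eqpoll_imp_lepoll by blast
    then show ?thesis
      using that[of j "elts i"] j(1) unbounded lepoll_Pow_self lepoll_trans by blast
  next
    case singular
    obtain t where t: "t \<in> elts i" "X \<lesssim> elts t"
      using lesspoll_Ord[OF Ord_i singular(2)] .
    have "\<exists>x\<in>X. j \<in> elts x" if "j \<in> elts i" for j
    proof -
      \<comment> \<open>Singularity yields only \<open>x\<close> at or above the given ordinal;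
        applying it to \<open>succ j\<close> makes \<open>x\<close> exceed \<open>j\<close>.\<close>
      have "succ j \<in> elts i"
        using limit_succ_mem[OF i(1) that] .
      then obtain x where x: "x \<in> X" "x \<notin> elts (succ j)"
        using singular(3) by blast
      moreover have "Ord x" "Ord j"
        using x(1) singular(1) that Ord_mem[OF Ord_i] by auto
      ultimately show ?thesis
        using Ord_linear[of x j] by auto
    qed
    then show ?thesis
      using that[OF t(1) singular(1)] lepoll_trans[OF t(2) lepoll_Pow_self] by blast
  next
    case power
    obtain t where t: "t \<in> elts i" "elts A \<lesssim> elts t"
      using lesspoll_Ord[OF Ord_i power(1)] .
    have "elts i \<lesssim> Pow (elts A)"
      using power(2) lepoll_linear[of "elts i" "Pow (elts A)"] eqpoll_sym eqpoll_imp_lepoll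
      unfolding lesspoll_def by blast
    then have "elts i \<lesssim> Pow (elts t)"
      using lepoll_trans[OF _ Pow_lepoll_mono[OF t(2)]] by blast
    then show ?thesis
      using that[of t "elts i"] t(1) unbounded by blast
  qed
qed

theorem proposition8p8:
  fixes \<kappa> :: "'v::zfc bound" and i :: 'v
  assumes "regular_bound \<kappa>"
    and "ord_below i \<kappa>"
    and "limit i" and "i \<noteq> vset {}"
    and "\<not> omega_cofinal i" and "\<not> weakly_compact i"
  shows "\<exists>a. ghost \<kappa> i a"
proof (cases "tree_property i")
  case True
  \<comment> \<open>This includes the possibility that \<open>i\<close> is not a regular
    cardinal.\<close>
  then have "\<not> strongly_inaccessible i"
    using assms(6) by (simp add: weakly_compact_def)
  then obtain t L where "t \<in> elts i" "L \<subseteq> elts i" "\<And>j. j \<in> elts i \<Longrightarrow> \<exists>x\<in>L. j \<in> elts x"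
    "L \<lesssim> Pow (elts t)"
    using not_strongly_inaccessible_cofinal[OF assms(3,4)] by metis
  then show ?thesis
    by (rule ghost_of_chains[OF assms(1-5)])
next
  case False
  then show ?thesis
    by (rule ghost_of_tree[OF assms(1-4)])
qed

end
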